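(* Let $G$ be an amenable Polish group and let $H$ be a closed normal subgroup of $G$ that is co-compact in $G$. Then $H$ (with the induced topology) is amenable.
   Context: A topological group $G$ is amenable if every continuous action of $G$ on a (nonempty) compact space $X$ admits a $G$-invariant regular Borel probability measure. (Compact spaces are Hausdorff.) A subgroup $H$ of a topological group $G$ is co-compact if the quotient space $G/H$ with the quotient topology is compact. A Polish group is a topological group whose topology is separable and completely metrizable. *)

theory Defs
  imports "HOL-Analysis.Analysis" "HOL-Probability.Probability_Measure" "HOL-Algebra.Group_Action" "HOL-Algebra.Left_Coset"
begin

(* clashes with the topological closure_of *)
no_notation eq_closure_of (\<open>closure'_of\<index>\<close>)

definition topological_group :: "('a, 'b) monoid_scheme \<Rightarrow> 'a topology \<Rightarrow> bool" where
  "topological_group G T \<longleftrightarrow>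
     group G \<and> topspace T = carrier G \<and>
     continuous_map (prod_topology T T) T (\<lambda>(x, y). x \<otimes>\<^bsub>G\<^esub> y) \<and>
     continuous_map T T (\<lambda>x. inv\<^bsub>G\<^esub> x)"

definition polish_group :: "('a, 'b) monoid_scheme \<Rightarrow> 'a topology \<Rightarrow> bool" where
  "polish_group G T \<longleftrightarrow>
     topological_group G T \<and> separable_space T \<and> completely_metrizable_space T"

definition continuous_action ::
  "('a, 'b) monoid_scheme \<Rightarrow> 'a topology \<Rightarrow> 'x topology \<Rightarrow> ('a \<Rightarrow> 'x \<Rightarrow> 'x) \<Rightarrow> bool" where
  "continuous_action G T X \<phi> \<longleftrightarrow>
     group_action G (topspace X) \<phi> \<and>
     continuous_map (prod_topology T X) X (\<lambda>(g, x). \<phi> g x)"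

definition regular_borel_prob :: "'x topology \<Rightarrow> 'x measure \<Rightarrow> bool" where
  "regular_borel_prob X M \<longleftrightarrow>
     prob_space M \<and> space M = topspace X \<and>
     sets M = sigma_sets (topspace X) {U. openin X U} \<and>
     (\<forall>A\<in>sets M. emeasure M A = (SUP K\<in>{K. compactin X K \<and> K \<subseteq> A}. emeasure M K)) \<and>
     (\<forall>A\<in>sets M. emeasure M A = (INF U\<in>{U. openin X U \<and> A \<subseteq> U}. emeasure M U))"

definition invariant_measure ::
  "('a, 'b) monoid_scheme \<Rightarrow> ('a \<Rightarrow> 'x \<Rightarrow> 'x) \<Rightarrow> 'x measure \<Rightarrow> bool" where
  "invariant_measure G \<phi> M \<longleftrightarrow> (\<forall>g\<in>carrier G. distr M M (\<phi> g) = M)"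

text \<open>
  A definition cannot quantify over all types, so the compact space ranges over the topologies
  on subsets of \<^typ>\<open>'a set set\<close>, where \<^typ>\<open>'a\<close> is the type of the group elements. This is no
  restriction: an orbit closure has at most as many points as there are families of subsets of
  the group, so every compact space with a continuous action contains an invariant closed
  subspace of this form. Theorem \<open>amenable_invariant_measure\<close> below yields the property for
  compact spaces over an arbitrary type.
\<close>

definition amenable :: "('a, 'b) monoid_scheme \<Rightarrow> 'a topology \<Rightarrow> bool" where
  "amenable G T \<longleftrightarrow>
     topological_group G T \<and>
     (\<forall>(X :: 'a set set topology) \<phi>.
        compact_space X \<longrightarrow> Hausdorff_space X \<longrightarrow> topspace X \<noteq> {} \<longrightarrow>
        continuous_action G T X \<phi> \<longrightarrow>
        (\<exists>M. regular_borel_prob X M \<and> invariant_measure G \<phi> M))"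

definition coset_topology :: "('a, 'b) monoid_scheme \<Rightarrow> 'a topology \<Rightarrow> 'a set \<Rightarrow> 'a set topology" where
  "coset_topology G T H =
     topology (\<lambda>U. U \<subseteq> lcosets\<^bsub>G\<^esub> H \<and> openin T {x \<in> topspace T. x <#\<^bsub>G\<^esub> H \<in> U})"

text \<open>In a topological group the quotient by a closed subgroup is Hausdorff, so this is not
  required separately.\<close>

definition cocompact :: "('a, 'b) monoid_scheme \<Rightarrow> 'a topology \<Rightarrow> 'a set \<Rightarrow> bool" where
  "cocompact G T H \<longleftrightarrow> compact_space (coset_topology G T H)"

lemma openin_coset_topology:
  "openin (coset_topology G T H) U \<longleftrightarrow>
     U \<subseteq> lcosets\<^bsub>G\<^esub> H \<and> openin T {x \<in> topspace T. x <#\<^bsub>G\<^esub> H \<in> U}"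
proof -
  let ?P = "\<lambda>U. U \<subseteq> lcosets\<^bsub>G\<^esub> H \<and> openin T {x \<in> topspace T. x <#\<^bsub>G\<^esub> H \<in> U}"
  have "istopology ?P"
    unfolding istopology_def
  proof (intro conjI allI impI)
    fix S S' assume S: "?P S" "?P S'"
    show "S \<inter> S' \<subseteq> lcosets\<^bsub>G\<^esub> H" using S by blast
    have "openin T ({x \<in> topspace T. x <#\<^bsub>G\<^esub> H \<in> S} \<inter> {x \<in> topspace T. x <#\<^bsub>G\<^esub> H \<in> S'})"
      using S by (intro openin_Int) simp_all
    also have "{x \<in> topspace T. x <#\<^bsub>G\<^esub> H \<in> S} \<inter> {x \<in> topspace T. x <#\<^bsub>G\<^esub> H \<in> S'} =
        {x \<in> topspace T. x <#\<^bsub>G\<^esub> H \<in> S \<inter> S'}" by blast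
    finally show "openin T {x \<in> topspace T. x <#\<^bsub>G\<^esub> H \<in> S \<inter> S'}" .
  next
    fix K assume K: "\<forall>S\<in>K. ?P S"
    show "\<Union>K \<subseteq> lcosets\<^bsub>G\<^esub> H" using K by blast
    have "{x \<in> topspace T. x <#\<^bsub>G\<^esub> H \<in> \<Union>K} =
        (\<Union>S\<in>K. {x \<in> topspace T. x <#\<^bsub>G\<^esub> H \<in> S})" by blast
    moreover have "openin T (\<Union>S\<in>K. {x \<in> topspace T. x <#\<^bsub>G\<^esub> H \<in> S})"
      using K by (intro openin_Union) auto
    ultimately show "openin T {x \<in> topspace T. x <#\<^bsub>G\<^esub> H \<in> \<Union>K}" by simp
  qed
  then show ?thesis
    unfolding coset_topology_def by (simp add: topology_inverse')
qed

lemma quotient_map_coset_topology: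
  assumes "topspace T = carrier G"
  shows "quotient_map T (coset_topology G T H) (\<lambda>x. x <#\<^bsub>G\<^esub> H)"
proof -
  have eq: "lcosets\<^bsub>G\<^esub> H = (\<lambda>x. x <#\<^bsub>G\<^esub> H) ` topspace T"
    using assms by (auto simp: LCOSETS_def)
  have "{x \<in> topspace T. x <#\<^bsub>G\<^esub> H \<in> lcosets\<^bsub>G\<^esub> H} = topspace T"
    unfolding eq by blast
  then have "openin (coset_topology G T H) (lcosets\<^bsub>G\<^esub> H)"
    unfolding openin_coset_topology by simp
  then have "topspace (coset_topology G T H) = lcosets\<^bsub>G\<^esub> H"
    by (meson openin_coset_topology openin_subset openin_topspace subset_antisym)
  then show ?thesis
    unfolding quotient_map_def openin_coset_topology by (auto simp: eq)
qed

lemma group_actionI: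
  assumes "group G"
    and "\<And>g. g \<in> carrier G \<Longrightarrow> \<phi> g \<in> extensional E"
    and maps: "\<And>g x. g \<in> carrier G \<Longrightarrow> x \<in> E \<Longrightarrow> \<phi> g x \<in> E"
    and one: "\<And>x. x \<in> E \<Longrightarrow> \<phi> \<one>\<^bsub>G\<^esub> x = x"
    and mult: "\<And>g h x. g \<in> carrier G \<Longrightarrow> h \<in> carrier G \<Longrightarrow> x \<in> E \<Longrightarrow> \<phi> (g \<otimes>\<^bsub>G\<^esub> h) x = \<phi> g (\<phi> h x)"
  shows "group_action G E \<phi>"
proof -
  interpret group G by fact
  have bij: "\<phi> g \<in> Bij E" if g: "g \<in> carrier G" for g
  proof -
    have "bij_betw (\<phi> g) E E"
    proof (rule bij_betw_byWitness[where f' = "\<phi> (inv\<^bsub>G\<^esub> g)"])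
      show "\<forall>a\<in>E. \<phi> (inv\<^bsub>G\<^esub> g) (\<phi> g a) = a"
        using g one mult[of "inv\<^bsub>G\<^esub> g" g] by (auto simp: l_inv)
      show "\<forall>a\<in>E. \<phi> g (\<phi> (inv\<^bsub>G\<^esub> g) a) = a"
        using g one mult[of g "inv\<^bsub>G\<^esub> g"] by (auto simp: r_inv)
    qed (use g maps in auto)
    then show ?thesis using assms(2)[OF g] by (simp add: Bij_def)
  qed
  have "\<phi> \<in> hom G (BijGroup E)"
  proof (rule homI)
    fix g h assume gh: "g \<in> carrier G" "h \<in> carrier G"
    have "\<phi> (g \<otimes>\<^bsub>G\<^esub> h) = compose E (\<phi> g) (\<phi> h)"
      using gh assms(2)[of "g \<otimes>\<^bsub>G\<^esub> h"] mult
      by (intro extensionalityI[of _ E]) (auto simp: compose_def)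
    then show "\<phi> (g \<otimes>\<^bsub>G\<^esub> h) = \<phi> g \<otimes>\<^bsub>BijGroup E\<^esub> \<phi> h"
      using gh bij by (simp add: BijGroup_def)
  qed (use bij in \<open>simp add: BijGroup_def\<close>)
  then show ?thesis
    by (simp add: group_action_def group_hom_def group_hom_axioms_def group_BijGroup assms(1))
qed

theorem amenable_invariant_measure:
  fixes G :: "('a, 'b) monoid_scheme" and X :: "'x topology"
  assumes "amenable G T" and "compact_space X" and "Hausdorff_space X" and "topspace X \<noteq> {}"
    and "continuous_action G T X \<phi>"
  shows "\<exists>M. regular_borel_prob X M \<and> invariant_measure G \<phi> M"
proof -
  have G: "group G" and TG: "topspace T = carrier G"
    using assms(1) by (auto simp: amenable_def topological_group_def)
  interpret group G by (rule G)
  interpret A: group_action G "topspace X" \<phi>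
    using assms(5) by (simp add: continuous_action_def)
  have cont: "continuous_map (prod_topology T X) X (\<lambda>(g, x). \<phi> g x)"
    using assms(5) by (simp add: continuous_action_def)
  have contg: "continuous_map X X (\<phi> g)" if "g \<in> carrier G" for g
  proof -
    have "continuous_map X (prod_topology T X) (\<lambda>x. (g, x))"
      using that TG by (simp add: continuous_map_pairwise o_def)
    from continuous_map_compose[OF this cont] show ?thesis by (simp add: o_def)
  qed
  obtain x0 where x0: "x0 \<in> topspace X" using assms(4) by blast
  define orb where "orb = (\<lambda>A. (\<lambda>a. \<phi> a x0) ` (A :: 'a set))"
  define Y where "Y = X closure_of (orb (carrier G))"
  have orbsub: "orb A \<subseteq> topspace X" if "A \<subseteq> carrier G" for A
    using that x0 A.element_image unfolding orb_def by blast
  have Ysub: "Y \<subseteq> topspace X" by (simp add: Y_def closure_of_subset_topspace)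
  have Ycl: "closedin X Y" by (simp add: Y_def)
  have orbY: "orb (carrier G) \<subseteq> Y"
    unfolding Y_def by (rule closure_of_subset) (rule orbsub, simp)
  have Yne: "Y \<noteq> {}" using orbY by (auto simp: orb_def)
  have comp: "\<phi> (g \<otimes>\<^bsub>G\<^esub> h) x = \<phi> g (\<phi> h x)"
    if "g \<in> carrier G" "h \<in> carrier G" "x \<in> topspace X" for g h x
    using that A.composition_rule by simp
  have YY: "\<phi> g y \<in> Y" if g: "g \<in> carrier G" and y: "y \<in> Y" for g y
  proof -
    have "\<phi> g ` orb (carrier G) \<subseteq> orb (carrier G)"
    proof
      fix z assume "z \<in> \<phi> g ` orb (carrier G)"
      then obtain h where "h \<in> carrier G" "z = \<phi> g (\<phi> h x0)" by (auto simp: orb_def)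
      then have "z = \<phi> (g \<otimes>\<^bsub>G\<^esub> h) x0" "g \<otimes>\<^bsub>G\<^esub> h \<in> carrier G"
        using comp g x0 by auto
      then show "z \<in> orb (carrier G)" by (auto simp: orb_def)
    qed
    then have "X closure_of (\<phi> g ` orb (carrier G)) \<subseteq> Y"
      unfolding Y_def by (rule closure_of_mono)
    moreover have "\<phi> g ` Y \<subseteq> X closure_of (\<phi> g ` orb (carrier G))"
      unfolding Y_def by (rule continuous_map_image_closure_subset[OF contg[OF g]])
    ultimately show ?thesis using y by blast
  qed
  define e where "e = (\<lambda>y. {A. A \<subseteq> carrier G \<and> y \<in> X closure_of (orb A)})"
  have inj: "inj_on e Y"
  proof (rule inj_onI, rule ccontr)
    fix y y' assume yy: "y \<in> Y" "y' \<in> Y" "e y = e y'" "y \<noteq> y'"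
    then obtain U V where UV: "openin X U" "openin X V" "y \<in> U" "y' \<in> V" "disjnt U V"
      using assms(3) Ysub unfolding Hausdorff_space_def by (meson subsetD)
    define A where "A = {g \<in> carrier G. \<phi> g x0 \<in> U}"
    have orbA: "orb A = U \<inter> orb (carrier G)" by (auto simp: A_def orb_def)
    have "y \<in> X closure_of (orb A)"
      unfolding in_closure_of
    proof (intro conjI allI impI)
      show "y \<in> topspace X" using yy Ysub by blast
      fix W assume W: "y \<in> W \<and> openin X W"
      then have "openin X (W \<inter> U)" "y \<in> W \<inter> U" using UV by auto
      then obtain z where "z \<in> orb (carrier G)" "z \<in> W \<inter> U"
        using yy(1) unfolding Y_def in_closure_of by blast
      then show "\<exists>z. z \<in> orb A \<and> z \<in> W" unfolding orbA by blast
    qed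
    then have "A \<in> e y" by (simp add: e_def A_def)
    then have "A \<in> e y'" using yy(3) by simp
    then have "y' \<in> X closure_of (orb A)" by (simp add: e_def)
    then obtain z where "z \<in> orb A" "z \<in> V" using UV unfolding in_closure_of by blast
    then show False using UV orbA by (auto simp: disjnt_def)
  qed
  define E where "E = e ` Y"
  define f where "f = inv_into Y e"
  have fe: "f (e y) = y" if "y \<in> Y" for y
    using that inj by (simp add: f_def)
  have ef: "e (f z) = z" and fY: "f z \<in> Y" if "z \<in> E" for z
    using that unfolding E_def f_def by (auto simp: f_inv_into_f inv_into_into)
  have eE: "e y \<in> E" if "y \<in> Y" for y using that by (simp add: E_def)
  define XY where "XY = subtopology X Y"
  have tXY: "topspace XY = Y" using Ysub by (auto simp: XY_def)
  define Z where "Z = pullback_topology E f XY"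
  have tZ: "topspace Z = E"
    using fY tXY by (auto simp: Z_def topspace_pullback_topology)
  have cf: "continuous_map Z XY f"
    using continuous_map_pullback[of XY XY id E f] by (simp add: Z_def)
  have ce: "continuous_map XY Z e"
    unfolding Z_def
  proof (rule continuous_map_pullback')
    show "continuous_map XY XY (f \<circ> e)"
      by (rule continuous_map_eq[of _ _ id]) (auto simp: tXY fe)
    show "topspace XY \<subseteq> e -` E" using eE by (auto simp: tXY)
  qed
  have hom: "homeomorphic_maps XY Z e f"
    unfolding homeomorphic_maps_def using ce cf by (simp add: tXY tZ fe ef)
  have homsp: "XY homeomorphic_space Z" using hom homeomorphic_space_def by blast
  have cfX: "continuous_map Z X f"
    using cf continuous_map_into_fulltopology unfolding XY_def by blast
  have ZC: "compact_space Z"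
    using homeomorphic_compact_space[OF homsp] Ycl assms(2) XY_def
    by (simp add: closedin_compact_space compact_space_subtopology)
  have ZH: "Hausdorff_space Z"
    using homeomorphic_Hausdorff_space[OF homsp] assms(3) XY_def
    by (simp add: Hausdorff_space_subtopology)
  define \<psi> where "\<psi> = (\<lambda>g. \<lambda>z\<in>E. e (\<phi> g (f z)))"
  have f\<psi>: "f (\<psi> g z) = \<phi> g (f z)" if "g \<in> carrier G" "z \<in> E" for g z
    using that by (simp add: \<psi>_def fe YY fY)
  have act: "group_action G (topspace Z) \<psi>"
  proof (rule group_actionI[OF G])
    fix g h z assume gh: "g \<in> carrier G" "h \<in> carrier G" and "z \<in> topspace Z"
    then have z: "z \<in> E" "f z \<in> Y" "f z \<in> topspace X" using tZ fY Ysub by auto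
    show "\<psi> (g \<otimes>\<^bsub>G\<^esub> h) z = \<psi> g (\<psi> h z)"
      using gh z by (simp add: \<psi>_def comp YY eE fe)
  next
    fix z assume "z \<in> topspace Z"
    then have z: "z \<in> E" "f z \<in> Y" "f z \<in> topspace X" using tZ fY Ysub by auto
    have "\<phi> \<one>\<^bsub>G\<^esub> (f z) = f z"
      using z A.id_eq_one by (metis restrict_apply')
    then show "\<psi> \<one>\<^bsub>G\<^esub> z = z" using z by (simp add: \<psi>_def ef)
  qed (auto simp: tZ \<psi>_def YY fY eE)
  have "continuous_map (prod_topology T Z) X (\<lambda>p. \<phi> (fst p) (f (snd p)))"
  proof -
    have "continuous_map (prod_topology T Z) (prod_topology T X) (\<lambda>p. (fst p, f (snd p)))"
      unfolding continuous_map_pairwise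
      using continuous_map_compose[OF continuous_map_snd cfX, of T]
      by (simp add: o_def continuous_map_fst)
    from continuous_map_compose[OF this cont] show ?thesis by (simp add: o_def)
  qed
  then have "continuous_map (prod_topology T Z) XY (\<lambda>p. \<phi> (fst p) (f (snd p)))"
    unfolding XY_def by (auto simp: continuous_map_in_subtopology TG tZ YY fY)
  then have "continuous_map (prod_topology T Z) Z (e \<circ> (\<lambda>p. \<phi> (fst p) (f (snd p))))"
    using ce by (rule continuous_map_compose)
  then have "continuous_map (prod_topology T Z) Z (\<lambda>(g, z). \<psi> g z)"
    by (rule continuous_map_eq) (auto simp: \<psi>_def tZ)
  with act have "continuous_action G T Z \<psi>" by (simp add: continuous_action_def)
  moreover have "topspace Z \<noteq> {}" using Yne by (simp add: tZ E_def)
  ultimately obtain N where N: "regular_borel_prob Z N" "invariant_measure G \<psi> N"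
    using assms(1) ZC ZH unfolding amenable_def by blast
  define B where "B = sigma (topspace X) {U. openin X U}"
  have opX: "{U. openin X U} \<subseteq> Pow (topspace X)" using openin_subset by blast
  have spB: "space B = topspace X" by (simp add: B_def space_measure_of[OF opX])
  have seB: "sets B = sigma_sets (topspace X) {U. openin X U}"
    by (simp add: B_def sets_measure_of[OF opX])
  have spN: "space N = E" and seN: "sets N = sigma_sets E {U. openin Z U}" and "prob_space N"
    using N(1) tZ by (auto simp: regular_borel_prob_def)
  have opN: "U \<in> sets N" if "openin Z U" for U using that seN by auto
  have opB: "U \<in> sets B" if "openin X U" for U using that seB by auto
  have mf: "f \<in> measurable N B"
    unfolding B_def
  proof (rule measurable_measure_of[OF opX])
    show "f \<in> space N \<rightarrow> topspace X" using fY Ysub spN by auto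
    fix U assume "U \<in> {U. openin X U}"
    then have "openin Z {z \<in> topspace Z. f z \<in> U}"
      using cfX openin_continuous_map_preimage by blast
    moreover have "{z \<in> topspace Z. f z \<in> U} = f -` U \<inter> space N" using tZ spN by auto
    ultimately show "f -` U \<inter> space N \<in> sets N" using opN by simp
  qed
  define M where "M = distr N B f"
  have eM: "emeasure M A = emeasure N (f -` A \<inter> E)" if "A \<in> sets B" for A
    using that mf by (simp add: M_def emeasure_distr spN)
  have fA: "f -` A \<inter> E \<in> sets N" if "A \<in> sets B" for A
    using measurable_sets[OF mf that] spN by simp
  have seM: "sets M = sets B" and spM: "space M = topspace X" by (simp_all add: M_def spB)
  have cptB: "K \<in> sets B" if "compactin X K" for K
  proof -
    have "closedin X K" using that assms(3) compactin_imp_closedin by blast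
    then have "topspace X - K \<in> sets B" "K \<subseteq> topspace X"
      using opB by (auto simp: closedin_def)
    then have "space B - (topspace X - K) \<in> sets B" "topspace X - (topspace X - K) = K"
      by auto
    then show ?thesis using spB by simp
  qed
  have inner: "emeasure M A = (SUP K\<in>{K. compactin X K \<and> K \<subseteq> A}. emeasure M K)"
    if A: "A \<in> sets M" for A
  proof (rule antisym)
    have "emeasure M A = emeasure N (f -` A \<inter> E)" using eM[of A] A seM by simp
    also have "\<dots> = (SUP K\<in>{K. compactin Z K \<and> K \<subseteq> f -` A \<inter> E}. emeasure N K)"
      using N(1) fA[of A] A seM unfolding regular_borel_prob_def by metis
    also have "\<dots> \<le> (SUP K\<in>{K. compactin X K \<and> K \<subseteq> A}. emeasure M K)"
    proof (rule SUP_mono)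
      fix K assume "K \<in> {K. compactin Z K \<and> K \<subseteq> f -` A \<inter> E}"
      then have K: "compactin Z K" "K \<subseteq> f -` A \<inter> E" by auto
      have c: "compactin X (f ` K)" using K(1) cfX by (rule image_compactin)
      have "f -` (f ` K) \<inter> E = K"
        using K(2) ef by (auto) (metis ef subsetD IntE)
      then have "emeasure N K = emeasure M (f ` K)" using eM[OF cptB[OF c]] by simp
      then show "\<exists>L\<in>{K. compactin X K \<and> K \<subseteq> A}. emeasure N K \<le> emeasure M L"
        using c K(2) by (intro bexI[of _ "f ` K"]) auto
    qed
    finally show "emeasure M A \<le> (SUP K\<in>{K. compactin X K \<and> K \<subseteq> A}. emeasure M K)" .
    show "(SUP K\<in>{K. compactin X K \<and> K \<subseteq> A}. emeasure M K) \<le> emeasure M A"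
      using A by (intro SUP_least emeasure_mono) auto
  qed
  have outer: "emeasure M A = (INF U\<in>{U. openin X U \<and> A \<subseteq> U}. emeasure M U)"
    if A: "A \<in> sets M" for A
  proof (rule antisym)
    show "emeasure M A \<le> (INF U\<in>{U. openin X U \<and> A \<subseteq> U}. emeasure M U)"
      using opB seM by (intro INF_greatest emeasure_mono) auto
    have "(INF U\<in>{U. openin X U \<and> A \<subseteq> U}. emeasure M U)
        \<le> (INF U\<in>{U. openin Z U \<and> f -` A \<inter> E \<subseteq> U}. emeasure N U)"
    proof (rule INF_mono)
      fix U assume "U \<in> {U. openin Z U \<and> f -` A \<inter> E \<subseteq> U}"
      then have U: "openin Z U" "f -` A \<inter> E \<subseteq> U" by auto
      from U(1) obtain V where V: "openin XY V" "U = f -` V \<inter> E"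
        unfolding Z_def openin_pullback_topology by blast
      then obtain W where W: "openin X W" "V = W \<inter> Y" unfolding XY_def openin_subtopology by blast
      define W' where "W' = W \<union> (topspace X - Y)"
      have o: "openin X W'" using W(1) Ycl unfolding W'_def by (intro openin_Un) auto
      have "A \<subseteq> W'"
      proof
        fix a assume a: "a \<in> A"
        then have "a \<in> topspace X" using A sets.sets_into_space spM by blast
        moreover have "a \<in> W" if "a \<in> Y"
        proof -
          have "e a \<in> U" using U(2) a that fe eE by auto
          then show ?thesis using V W fe that by auto
        qed
        ultimately show "a \<in> W'" by (auto simp: W'_def)
      qed
      moreover have "f -` W' \<inter> E = U" using V W fY by (auto simp: W'_def)
      then have "emeasure M W' = emeasure N U" using eM[OF opB[OF o]] by simp
      ultimately show "\<exists>L\<in>{U. openin X U \<and> A \<subseteq> U}. emeasure M L \<le> emeasure N U"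
        using o by (intro bexI[of _ W']) auto
    qed
    also have "\<dots> = emeasure N (f -` A \<inter> E)"
      using N(1) fA[of A] A seM unfolding regular_borel_prob_def by metis
    also have "\<dots> = emeasure M A" using eM[of A] A seM by simp
    finally show "(INF U\<in>{U. openin X U \<and> A \<subseteq> U}. emeasure M U) \<le> emeasure M A" .
  qed
  have "prob_space M"
    unfolding M_def using \<open>prob_space N\<close> mf by (rule prob_space.prob_space_distr)
  then have "regular_borel_prob X M"
    unfolding regular_borel_prob_def using inner outer seM seB spM by blast
  moreover have "distr M M (\<phi> g) = M" if g: "g \<in> carrier G" for g
  proof -
    have m1: "\<phi> g \<in> measurable B B"
    proof -
      have "\<phi> g \<in> measurable B (sigma (topspace X) {U. openin X U})"
      proof (rule measurable_measure_of[OF opX])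
        show "\<phi> g \<in> space B \<rightarrow> topspace X"
          using continuous_map_funspace[OF contg[OF g]] spB by simp
        fix U assume "U \<in> {U. openin X U}"
        then have "openin X {x \<in> topspace X. \<phi> g x \<in> U}"
          using contg[OF g] openin_continuous_map_preimage by blast
        moreover have "{x \<in> topspace X. \<phi> g x \<in> U} = \<phi> g -` U \<inter> space B" using spB by auto
        ultimately show "\<phi> g -` U \<inter> space B \<in> sets B" using opB by simp
      qed
      then show ?thesis by (simp add: B_def)
    qed
    have inv: "distr N N (\<psi> g) = N" using N(2) g by (simp add: invariant_measure_def)
    have m2: "\<psi> g \<in> measurable N N"
    proof -
      have opZ: "{U. openin Z U} \<subseteq> Pow E" using openin_subset tZ by blast
      have *: "sets (sigma E {U. openin Z U}) = sets N" by (simp add: seN sets_measure_of[OF opZ])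
      have cz: "continuous_map Z Z (\<psi> g)"
      proof -
        have "continuous_map Z XY (\<phi> g \<circ> f)"
          unfolding XY_def continuous_map_in_subtopology
          using continuous_map_compose[OF cfX contg[OF g]] g by (auto simp: tZ YY fY)
        from continuous_map_compose[OF this ce] show ?thesis
          by (rule continuous_map_eq) (auto simp: \<psi>_def tZ)
      qed
      have "\<psi> g \<in> measurable N (sigma E {U. openin Z U})"
      proof (rule measurable_measure_of[OF opZ])
        show "\<psi> g \<in> space N \<rightarrow> E" using continuous_map_funspace[OF cz] tZ spN by simp
        fix U assume "U \<in> {U. openin Z U}"
        then have "openin Z {x \<in> topspace Z. \<psi> g x \<in> U}"
          using cz openin_continuous_map_preimage by blast
        moreover have "{x \<in> topspace Z. \<psi> g x \<in> U} = \<psi> g -` U \<inter> space N" using spN tZ by auto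
        ultimately show "\<psi> g -` U \<inter> space N \<in> sets N" using opN by simp
      qed
      then show ?thesis using * measurable_cong_sets by blast
    qed
    have "distr M M (\<phi> g) = distr M B (\<phi> g)" by (rule distr_cong) (auto simp: seM)
    also have "\<dots> = distr N B (\<phi> g \<circ> f)" unfolding M_def by (rule distr_distr[OF m1 mf])
    also have "\<dots> = distr N B (f \<circ> \<psi> g)"
      by (rule distr_cong) (auto simp: spN f\<psi> g)
    also have "\<dots> = distr (distr N N (\<psi> g)) B f" by (rule distr_distr[OF mf m2, symmetric])
    also have "\<dots> = M" by (simp add: inv M_def)
    finally show ?thesis .
  qed
  ultimately show ?thesis unfolding invariant_measure_def by blast
qed

end

theory Submission
  imports Defs
begin

text \<open>
  Induce an \<open>H\<close>-space \<open>X\<close> to the \<open>G\<close>-space \<open>Y = G \<times>\<^bsub>H\<^esub> X\<close>, the quotient of \<open>G \<times> X\<close> by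
  \<open>h \<cdot> (a, x) = (a h\<^sup>-\<^sup>1, h x)\<close>. It fibres over \<open>G/H\<close> with fibre \<open>X\<close>, so it is compact, and amenability
  of \<open>G\<close> provides a \<open>G\<close>-invariant measure on it. By compactness the preimage in \<open>Y\<close> of a neighbourhood
  of \<open>H \<in> G/H\<close> has positive measure, and as \<open>H\<close> is normal it acts trivially on \<open>G/H\<close>; hence the
  conditional measures on these preimages are \<open>H\<close>-invariant. A cluster point of them, as the
  neighbourhood shrinks, is a finitely additive \<open>H\<close>-invariant mean concentrated near the fibre over
  \<open>H\<close>, which is \<open>X\<close> as an \<open>H\<close>-space. Its outer values on compact subsets of the fibre form a content,
  and the regular Borel measure of that content is the one required.
\<close>

section \<open>Borel sigma-algebras and continuous maps\<close>

lemma sets_sigma_open: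
  "sets (sigma (topspace X) {U. openin X U}) = sigma_sets (topspace X) {U. openin X U}"
  by (rule sets_measure_of) (use openin_subset in blast)

lemma regular_borel_probD:
  assumes "regular_borel_prob X M"
  shows "prob_space M" and "space M = topspace X"
    and "sets M = sigma_sets (topspace X) {U. openin X U}"
  using assms by (auto simp: regular_borel_prob_def)

lemma continuous_map_measurable:
  assumes "continuous_map X Y f"
    and "space M = topspace X" and "sets M = sigma_sets (topspace X) {U. openin X U}"
    and "sets N = sigma_sets (topspace Y) {U. openin Y U}"
  shows "f \<in> measurable M N"
proof -
  have "f \<in> measurable M (sigma (topspace Y) {U. openin Y U})"
  proof (rule measurable_measure_of)
    show "{U. openin Y U} \<subseteq> Pow (topspace Y)" using openin_subset by blast
    show "f \<in> space M \<rightarrow> topspace Y"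
      using continuous_map_funspace[OF assms(1)] assms(2) by simp
    fix U assume "U \<in> {U. openin Y U}"
    then have "openin X {x \<in> topspace X. f x \<in> U}"
      using assms(1) openin_continuous_map_preimage by blast
    moreover have "{x \<in> topspace X. f x \<in> U} = f -` U \<inter> space M" using assms(2) by auto
    ultimately show "f -` U \<inter> space M \<in> sets M" using assms(3) by auto
  qed
  also have "measurable M (sigma (topspace Y) {U. openin Y U}) = measurable M N"
    by (rule measurable_cong_sets) (simp_all only: assms(4) sets_sigma_open)
  finally show ?thesis .
qed

section \<open>Regular Borel measures from contents\<close>

text \<open>A content in the classical sense, of total mass 1. It is given on the closed sets, which
  are the compact ones here, and is only finitely additive; compactness later supplies the countable
  part. As \<open>c\<close> is not assumed regular, the measure built from it may exceed
  \<open>c\<close> on closed sets.\<close>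

locale normalized_content =
  fixes X :: "'x topology" and c :: "'x set \<Rightarrow> ennreal"
  assumes compact: "compact_space X" and Hausdorff: "Hausdorff_space X"
    and mono: "\<And>K L. closedin X K \<Longrightarrow> closedin X L \<Longrightarrow> K \<subseteq> L \<Longrightarrow> c K \<le> c L"
    and subadditive: "\<And>K L. closedin X K \<Longrightarrow> closedin X L \<Longrightarrow> c (K \<union> L) \<le> c K + c L"
    and superadditive:
      "\<And>K L. closedin X K \<Longrightarrow> closedin X L \<Longrightarrow> K \<inter> L = {} \<Longrightarrow> c K + c L \<le> c (K \<union> L)"
    and total: "c (topspace X) = 1"
begin

definition open_content :: "'x set \<Rightarrow> ennreal" where
  "open_content V = (SUP K\<in>{K. closedin X K \<and> K \<subseteq> V}. c K)"

definition outer_content :: "'x set \<Rightarrow> ennreal" where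
  "outer_content A = (INF V\<in>{V. openin X V \<and> A \<subseteq> V}. open_content V)"

lemma compactin_iff_closedin: "compactin X K \<longleftrightarrow> closedin X K"
  using compact Hausdorff closedin_compact_space compactin_imp_closedin by blast

text \<open>Superadditivity for two empty sets doubles the value; the cancellation is legitimate
  because monotonicity and \<open>total\<close> make it finite.\<close>

lemma content_empty: "c {} = 0"
proof -
  have "c {} + c {} \<le> 0 + c {}" using superadditive[of "{}" "{}"] by simp
  moreover have "c {} \<noteq> \<infinity>" using mono[of "{}" "topspace X"] total by (auto simp: top_unique)
  ultimately show ?thesis by (metis ennreal_add_left_cancel_le add.commute le_zero_eq)
qed

lemma open_content_mono: "U \<subseteq> V \<Longrightarrow> open_content U \<le> open_content V"
  unfolding open_content_def by (rule SUP_subset_mono) auto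

lemma content_le_open: "closedin X K \<Longrightarrow> K \<subseteq> V \<Longrightarrow> c K \<le> open_content V"
  unfolding open_content_def by (rule SUP_upper) simp

lemma open_content_empty: "open_content {} = 0"
proof -
  have "{K. closedin X K \<and> K \<subseteq> {}} = {{}}" by auto
  then show ?thesis by (simp add: open_content_def content_empty)
qed

text \<open>A closed \<open>K\<close> inside the union is cut into closed pieces, one in each open
  set: the disjoint compact sets \<open>K - U\<close> and \<open>K - V\<close> have disjoint open
  neighbourhoods \<open>A\<close> and \<open>B\<close>, so \<open>K - A\<close> lies in
  \<open>U\<close>, \<open>K - B\<close> lies in \<open>V\<close>, and together they are
  \<open>K\<close>.\<close>

lemma open_content_Un:
  assumes U: "openin X U" and V: "openin X V"
  shows "open_content (U \<union> V) \<le> open_content U + open_content V"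
  unfolding open_content_def[of "U \<union> V"]
proof (rule SUP_least, clarify)
  fix K assume K: "closedin X K" "K \<subseteq> U \<union> V"
  have "compactin X (K - U)" "compactin X (K - V)"
    using K U V by (auto simp: compactin_iff_closedin)
  moreover have "disjnt (K - U) (K - V)" using K by (auto simp: disjnt_def)
  ultimately obtain A B where AB: "openin X A" "openin X B" "K - U \<subseteq> A" "K - V \<subseteq> B" "disjnt A B"
    using Hausdorff_space_compact_separation[OF Hausdorff] by metis
  have cl: "closedin X (K - A)" "closedin X (K - B)" using K AB by auto
  have "K = (K - A) \<union> (K - B)" using AB(5) by (auto simp: disjnt_def)
  then have "c K \<le> c (K - A) + c (K - B)" using subadditive[OF cl] by simp
  also have "\<dots> \<le> open_content U + open_content V"
    using AB cl by (intro add_mono content_le_open) auto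
  finally show "c K \<le> open_content U + open_content V" .
qed

lemma open_content_UN:
  assumes "finite I" "\<And>i. i \<in> I \<Longrightarrow> openin X (V i)"
  shows "open_content (\<Union>i\<in>I. V i) \<le> (\<Sum>i\<in>I. open_content (V i))"
  using assms
proof (induction I rule: finite_induct)
  case (insert i I)
  have "open_content (\<Union>i\<in>insert i I. V i) \<le> open_content (V i) + open_content (\<Union>i\<in>I. V i)"
    using open_content_Un[of "V i" "\<Union>i\<in>I. V i"] insert.prems by (auto simp: openin_Union)
  also have "\<dots> \<le> open_content (V i) + (\<Sum>i\<in>I. open_content (V i))"
    using insert by (intro add_left_mono) auto
  finally show ?case using insert.hyps by simp
qed (simp add: open_content_empty)

text \<open>A closed subset of the union is compact, hence covered by finitely many of the
  \<open>V i\<close>. This is where countable subadditivity comes from a finitely additive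
  content.\<close>

lemma open_content_UN_nat:
  fixes V :: "nat \<Rightarrow> 'x set"
  assumes "\<And>i. openin X (V i)"
  shows "open_content (\<Union>i. V i) \<le> (\<Sum>i. open_content (V i))"
  unfolding open_content_def[of "\<Union>i. V i"]
proof (rule SUP_least, clarify)
  fix K assume K: "closedin X K" "K \<subseteq> (\<Union>i. V i)"
  then have "compactin X K" by (simp add: compactin_iff_closedin)
  then obtain F where "finite F" "F \<subseteq> range V" "K \<subseteq> \<Union>F"
    using compactinD[of X K "range V"] K assms by blast
  then obtain I where I: "finite I" "K \<subseteq> (\<Union>i\<in>I. V i)"
    by (metis finite_subset_image)
  have "c K \<le> open_content (\<Union>i\<in>I. V i)" using K I by (intro content_le_open)
  also have "\<dots> \<le> (\<Sum>i\<in>I. open_content (V i))" using I assms by (intro open_content_UN) auto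
  also have "\<dots> \<le> (\<Sum>i. open_content (V i))" using I by (intro sum_le_suminf) auto
  finally show "c K \<le> (\<Sum>i. open_content (V i))" .
qed

lemma outer_content_open: "openin X V \<Longrightarrow> outer_content V = open_content V"
  unfolding outer_content_def by (intro antisym INF_lower INF_greatest) (auto intro: open_content_mono)

lemma outer_content_mono: "A \<subseteq> B \<Longrightarrow> outer_content A \<le> outer_content B"
  unfolding outer_content_def by (rule INF_superset_mono) auto

lemma outer_content_le: "openin X V \<Longrightarrow> A \<subseteq> V \<Longrightarrow> outer_content A \<le> open_content V"
  unfolding outer_content_def by (rule INF_lower) simp

lemma outer_content_topspace: "outer_content (topspace X) = 1"
proof -
  have "open_content (topspace X) = c (topspace X)"
    unfolding open_content_def by (intro antisym SUP_least SUP_upper) (auto intro: mono)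
  then show ?thesis by (simp add: outer_content_open total)
qed

lemma outer_measure_space: "outer_measure_space (Pow (topspace X)) outer_content"
  unfolding outer_measure_space_def
proof (intro conjI)
  show "positive (Pow (topspace X)) outer_content"
    by (simp add: positive_def outer_content_open open_content_empty)
  show "increasing (Pow (topspace X)) outer_content"
    by (simp add: increasing_def outer_content_mono)
  show "countably_subadditive (Pow (topspace X)) outer_content"
    unfolding countably_subadditive_def
  proof (intro allI impI)
    fix A :: "nat \<Rightarrow> 'x set" assume A: "range A \<subseteq> Pow (topspace X)"
    show "outer_content (\<Union>i. A i) \<le> (\<Sum>i. outer_content (A i))"
    proof (rule ennreal_le_epsilon)
      fix e :: real assume e: "0 < e" "(\<Sum>i. outer_content (A i)) < top_class.top"
      \<comment> \<open>The error allotted to index \<open>i\<close> is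
        \<open>e * (1/2) ^ Suc i\<close>; the exponent \<open>Suc i\<close> makes the errors add up
        to exactly \<open>e\<close>. Approximating the infimum needs a finite value, and all values
        are at most 1.\<close>
      have "\<exists>V. openin X V \<and> A i \<subseteq> V \<and> open_content V \<le> outer_content (A i) + e * (1/2) ^ Suc i" for i
      proof -
        have "outer_content (A i) \<noteq> \<infinity>"
          using outer_content_mono[of "A i" "topspace X"] A outer_content_topspace
          by (force simp: top_unique)
        then show ?thesis
          using INF_approx_ennreal[of "e * (1/2) ^ Suc i", OF _ outer_content_def[of "A i"]] e
          by (force intro: less_imp_le)
      qed
      then obtain V where V: "\<And>i. openin X (V i)" "\<And>i. A i \<subseteq> V i"
        "\<And>i. open_content (V i) \<le> outer_content (A i) + e * (1/2) ^ Suc i" by metis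
      have "outer_content (\<Union>i. A i) \<le> open_content (\<Union>i. V i)"
        using V by (intro outer_content_le openin_Union) auto
      also have "\<dots> \<le> (\<Sum>i. open_content (V i))" using V by (intro open_content_UN_nat)
      also have "\<dots> \<le> (\<Sum>i. outer_content (A i) + e * (1/2) ^ Suc i)"
        using V by (intro suminf_le) auto
      also have "\<dots> = (\<Sum>i. outer_content (A i)) + (\<Sum>i. ennreal e * ennreal ((1/2) ^ Suc i))"
        using e by (subst suminf_add[symmetric])
          (auto simp del: ennreal_suminf_cmult simp add: ennreal_mult[symmetric])
      also have "\<dots> = (\<Sum>i. outer_content (A i)) + e"
        unfolding ennreal_suminf_cmult
        by (subst suminf_ennreal_eq[OF zero_le_power power_half_series]) auto
      finally show "outer_content (\<Union>i. A i) \<le> (\<Sum>i. outer_content (A i)) + e" .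
    qed
  qed
qed

text \<open>Caratheodory's inequality for an open test set \<open>U\<close>. A closed
  \<open>K\<close> in \<open>U \<inter> V\<close> leaves the open set \<open>U - K\<close>, which
  contains \<open>U - V\<close>; any closed \<open>L\<close> in \<open>U - K\<close> is disjoint
  from \<open>K\<close>, so superadditivity bounds \<open>c K + c L\<close> by the content of
  \<open>U\<close>. Suprema over \<open>L\<close> and then over \<open>K\<close> finish.\<close>

lemma open_content_split:
  assumes U: "openin X U" and V: "openin X V"
  shows "outer_content (U \<inter> V) + outer_content (U - V) \<le> open_content U"
proof -
  \<comment> \<open>Addition commutes with a supremum only over a nonempty family; the empty set is
    always a member.\<close>
  have ne: "{K. closedin X K \<and> K \<subseteq> W} \<noteq> {}" for W by (auto intro: exI[of _ "{}"])
  have "c K + outer_content (U - V) \<le> open_content U" if K: "closedin X K" "K \<subseteq> U \<inter> V" for K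
  proof -
    have "c K + outer_content (U - V) \<le> c K + open_content (U - K)"
      using K U by (intro add_left_mono outer_content_le) auto
    also have "\<dots> = (SUP L\<in>{L. closedin X L \<and> L \<subseteq> U - K}. c K + c L)"
      unfolding open_content_def by (rule ennreal_SUP_add_right[OF ne])
    also have "\<dots> \<le> open_content U"
    proof (rule SUP_least, clarify)
      fix L assume L: "closedin X L" "L \<subseteq> U - K"
      then have "c K + c L \<le> c (K \<union> L)" using K by (intro superadditive) auto
      also have "\<dots> \<le> open_content U" using K L by (intro content_le_open) auto
      finally show "c K + c L \<le> open_content U" .
    qed
    finally show ?thesis .
  qed
  then have "(SUP K\<in>{K. closedin X K \<and> K \<subseteq> U \<inter> V}. c K + outer_content (U - V)) \<le> open_content U"
    by (intro SUP_least) auto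
  also have "(SUP K\<in>{K. closedin X K \<and> K \<subseteq> U \<inter> V}. c K + outer_content (U - V)) =
      outer_content (U \<inter> V) + outer_content (U - V)"
    unfolding ennreal_SUP_add_left[OF ne] outer_content_open[OF openin_Int[OF U V]]
    by (simp only: open_content_def)
  finally show ?thesis .
qed

text \<open>One half of Caratheodory's condition is subadditivity. The other is known for open test
  sets, and an arbitrary \<open>A\<close> is reached through the infimum over the open sets
  containing it.\<close>

lemma openin_lambda_system:
  assumes V: "openin X V"
  shows "V \<in> lambda_system (topspace X) (Pow (topspace X)) outer_content"
proof -
  interpret sigma_algebra "topspace X" "Pow (topspace X)" by (rule sigma_algebra_Pow)
  have "outer_content (A \<inter> V) + outer_content (A - V) = outer_content A" if A: "A \<subseteq> topspace X" for A
  proof (rule antisym)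
    have "outer_content ((A \<inter> V) \<union> (A - V)) \<le> outer_content (A \<inter> V) + outer_content (A - V)"
    proof (rule subadditiveD)
      show "Measure_Space.subadditive (Pow (topspace X)) outer_content"
        using outer_measure_space countably_subadditive_subadditive
        unfolding outer_measure_space_def by blast
    qed (use A in auto)
    moreover have "(A \<inter> V) \<union> (A - V) = A" by blast
    ultimately show "outer_content A \<le> outer_content (A \<inter> V) + outer_content (A - V)" by simp
    show "outer_content (A \<inter> V) + outer_content (A - V) \<le> outer_content A"
      unfolding outer_content_def[of A]
    proof (rule INF_greatest, clarify)
      fix U assume U: "openin X U" "A \<subseteq> U"
      have "outer_content (A \<inter> V) + outer_content (A - V) \<le> outer_content (U \<inter> V) + outer_content (U - V)"
        using U by (intro add_mono outer_content_mono) auto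
      also have "\<dots> \<le> open_content U" by (rule open_content_split[OF U(1) V])
      finally show "outer_content (A \<inter> V) + outer_content (A - V) \<le> open_content U" .
    qed
  qed
  then show ?thesis using openin_subset[OF V] by (auto simp: lambda_system_eq)
qed

text \<open>The Caratheodory-measurable sets form a sigma-algebra containing the open sets, so the
  outer measure restricts to a measure on the Borel sets.\<close>

lemma measure_space_outer: "measure_space (topspace X) (sigma_sets (topspace X) {U. openin X U}) outer_content"
proof -
  let ?L = "lambda_system (topspace X) (Pow (topspace X)) outer_content"
  have L: "measure_space (topspace X) ?L outer_content"
    by (rule sigma_algebra.caratheodory_lemma[OF sigma_algebra_Pow outer_measure_space])
  then have "sigma_algebra (topspace X) ?L" by (simp add: measure_space_def)
  then have "sigma_sets (topspace X) {U. openin X U} \<subseteq> ?L"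
    by (rule sigma_algebra.sigma_sets_subset) (auto intro: openin_lambda_system)
  then show ?thesis
    using L openin_subset by (intro measure_down[OF L] sigma_algebra_sigma_sets) auto
qed

definition borel_measure :: "'x measure" where
  "borel_measure = measure_of (topspace X) (sigma_sets (topspace X) {U. openin X U}) outer_content"

lemma sets_borel_measure: "sets borel_measure = sigma_sets (topspace X) {U. openin X U}"
  and space_borel_measure: "space borel_measure = topspace X"
proof -
  have *: "sigma_sets (topspace X) {U. openin X U} \<subseteq> Pow (topspace X)"
    using measure_space_outer by (rule measure_space_closed)
  show "sets borel_measure = sigma_sets (topspace X) {U. openin X U}"
    using sigma_algebra.sigma_sets_eq[of "topspace X" "sigma_sets (topspace X) {U. openin X U}"]
      measure_space_outer sets_measure_of[OF *]
    unfolding borel_measure_def measure_space_def by blast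
  show "space borel_measure = topspace X" using space_measure_of[OF *] by (simp add: borel_measure_def)
qed

lemma emeasure_borel_measure: "A \<in> sets borel_measure \<Longrightarrow> emeasure borel_measure A = outer_content A"
  unfolding borel_measure_def
  by (rule emeasure_measure_of_sigma)
    (use measure_space_outer sets_borel_measure in \<open>auto simp: borel_measure_def measure_space_def\<close>)

lemma openin_borel_measure: "openin X U \<Longrightarrow> U \<in> sets borel_measure"
  by (simp add: sets_borel_measure sigma_sets.Basic)

sublocale prob_space borel_measure
  by (rule prob_spaceI) (simp add: space_borel_measure emeasure_borel_measure openin_borel_measure outer_content_topspace)

text \<open>Outer regularity is built into \<open>outer_content\<close>. Inner regularity of
  \<open>A\<close> is outer regularity of its complement: the complement of an open set slightly
  larger than \<open>topspace X - A\<close> is a closed subset of \<open>A\<close> that loses at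
  most \<open>e\<close>, as the total mass is finite.\<close>

lemma regular_borel_prob_borel_measure: "regular_borel_prob X borel_measure"
  unfolding regular_borel_prob_def
proof (intro conjI ballI)
  fix A assume A: "A \<in> sets borel_measure"
  have "emeasure borel_measure A = (INF U\<in>{U. openin X U \<and> A \<subseteq> U}. open_content U)"
    using A by (simp add: emeasure_borel_measure outer_content_def)
  also have "\<dots> = (INF U\<in>{U. openin X U \<and> A \<subseteq> U}. emeasure borel_measure U)"
    by (rule INF_cong) (auto simp: emeasure_borel_measure openin_borel_measure outer_content_open)
  finally show "emeasure borel_measure A = (INF U\<in>{U. openin X U \<and> A \<subseteq> U}. emeasure borel_measure U)" .
next
  fix A assume A: "A \<in> sets borel_measure"
  show "emeasure borel_measure A = (SUP K\<in>{K. compactin X K \<and> K \<subseteq> A}. emeasure borel_measure K)"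
  proof (rule antisym)
    show "(SUP K\<in>{K. compactin X K \<and> K \<subseteq> A}. emeasure borel_measure K) \<le> emeasure borel_measure A"
      using A by (intro SUP_least emeasure_mono) auto
    show "emeasure borel_measure A \<le> (SUP K\<in>{K. compactin X K \<and> K \<subseteq> A}. emeasure borel_measure K)"
    proof (rule ennreal_le_epsilon)
      fix e :: real assume e: "0 < e"
      let ?B = "topspace X - A"
      have B: "?B \<in> sets borel_measure" 
        using sets.compl_sets[OF A] by (simp only: space_borel_measure)
      then have "outer_content ?B \<noteq> \<infinity>"
        using emeasure_finite[of ?B] by (simp add: emeasure_borel_measure)
      then obtain V where V: "openin X V" "?B \<subseteq> V" "open_content V < outer_content ?B + e"
        using INF_approx_ennreal[OF e outer_content_def[of ?B]] by auto
      let ?K = "topspace X - V"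
      have K: "closedin X ?K" "?K \<subseteq> A" using V by auto
      have "prob V \<le> prob ?B + e"
      proof -
        have "ennreal (prob V) \<le> ennreal (prob ?B) + ennreal e"
          using V B by (simp add: emeasure_eq_measure[symmetric] emeasure_borel_measure openin_borel_measure
              outer_content_open less_imp_le)
        then show ?thesis using e by (simp flip: ennreal_plus)
      qed
      moreover have "prob ?B = 1 - prob A" "prob ?K = 1 - prob V"
        using prob_compl A V openin_borel_measure by (auto simp: space_borel_measure)
      ultimately have "prob A \<le> prob ?K + e" by simp
      then have "emeasure borel_measure A \<le> emeasure borel_measure ?K + e"
        using e by (simp add: emeasure_eq_measure flip: ennreal_plus)
      also have "\<dots> \<le> (SUP K\<in>{K. compactin X K \<and> K \<subseteq> A}. emeasure borel_measure K) + e"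
        using K by (intro add_right_mono SUP_upper) (auto simp: compactin_iff_closedin)
      finally show "emeasure borel_measure A \<le> (SUP K\<in>{K. compactin X K \<and> K \<subseteq> A}. emeasure borel_measure K) + e" .
    qed
  qed
qed (simp_all add: sets_borel_measure space_borel_measure prob_space_axioms)

text \<open>A one-sided comparison of contents suffices. It passes to open sets, then to outer
  values, and yields that the image measure is at most the original one; between probability
  measures this forces equality.\<close>

lemma distr_borel_measure:
  assumes f: "continuous_map X X f" and le: "\<And>K. closedin X K \<Longrightarrow> c K \<le> c (f ` K)"
  shows "distr borel_measure borel_measure f = borel_measure"
proof -
  have mf: "f \<in> measurable borel_measure borel_measure"
    using continuous_map_measurable[OF f space_borel_measure sets_borel_measure sets_borel_measure] .
  interpret N: prob_space "distr borel_measure borel_measure f" by (rule prob_space_distr[OF mf])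
  define P where "P A = f -` A \<inter> topspace X" for A
  have PE: "P A \<in> sets borel_measure" "N.prob A = prob (P A)" if "A \<in> sets borel_measure" for A
    using that mf measurable_sets[OF mf that] by (auto simp: measure_distr P_def space_borel_measure)
  \<comment> \<open>A closed part of the preimage is compact, so its image is again closed and lies
    in \<open>U\<close>, where the hypothesis compares the two contents.\<close>
  have inn: "open_content (P U) \<le> open_content U" for U
    unfolding open_content_def[of "P U"]
  proof (rule SUP_least, clarify)
    fix K assume K: "closedin X K" "K \<subseteq> P U"
    have "closedin X (f ` K)" using K f image_compactin compactin_iff_closedin by metis
    with K have "c (f ` K) \<le> open_content U" by (intro content_le_open) (auto simp: P_def)
    with le[OF K(1)] show "c K \<le> open_content U" by order
  qed
  have out: "outer_content (P A) \<le> outer_content A" for A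
    unfolding outer_content_def[of A]
  proof (rule INF_greatest, clarify)
    fix U assume U: "openin X U" "A \<subseteq> U"
    have "P U = {x \<in> topspace X. f x \<in> U}" by (auto simp: P_def)
    then have "openin X (P U)" using openin_continuous_map_preimage[OF f U(1)] by simp
    moreover have "P A \<subseteq> P U" using U by (auto simp: P_def)
    ultimately show "outer_content (P A) \<le> open_content U" using outer_content_le inn order_trans by blast
  qed
  have N_le: "N.prob A \<le> prob A" if "A \<in> sets borel_measure" for A
  proof -
    have "emeasure borel_measure (P A) \<le> emeasure borel_measure A"
      using out PE(1)[OF that] that by (simp add: emeasure_borel_measure)
    then show ?thesis using PE(2)[OF that] by (simp add: emeasure_eq_measure)
  qed
  show ?thesis
  proof (rule measure_eqI)
    fix A assume "A \<in> sets (distr borel_measure borel_measure f)"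
    then have A: "A \<in> sets borel_measure" by simp
    have "N.prob (topspace X - A) = 1 - N.prob A" "prob (topspace X - A) = 1 - prob A"
      using A N.prob_compl[of A] prob_compl[of A] by (simp_all add: space_borel_measure)
    moreover have "topspace X - A \<in> sets borel_measure" 
        using sets.compl_sets[OF A] by (simp only: space_borel_measure)
    \<comment> \<open>Both masses are 1, so the inequality for the complement of \<open>A\<close> is
      the reverse inequality for \<open>A\<close>.\<close>
    ultimately have "N.prob A = prob A" using N_le[of A] N_le[of "topspace X - A"] A by simp
    then show "emeasure (distr borel_measure borel_measure f) A = emeasure borel_measure A"
      by (simp add: N.emeasure_eq_measure emeasure_eq_measure)
  qed simp
qed

end

section \<open>Quotient topologies on the image of a map\<close>

definition final_topology :: "'x topology \<Rightarrow> ('x \<Rightarrow> 'y) \<Rightarrow> 'y topology" where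
  "final_topology X q =
     topology (\<lambda>U. U \<subseteq> q ` topspace X \<and> openin X {x \<in> topspace X. q x \<in> U})"

lemma openin_final_topology:
  "openin (final_topology X q) U \<longleftrightarrow>
     U \<subseteq> q ` topspace X \<and> openin X {x \<in> topspace X. q x \<in> U}"
proof -
  have "istopology (\<lambda>U. U \<subseteq> q ` topspace X \<and> openin X {x \<in> topspace X. q x \<in> U})" (is "istopology ?P")
    unfolding istopology_def
  proof (intro conjI allI impI)
    fix S S' assume S: "?P S" "?P S'"
    show "S \<inter> S' \<subseteq> q ` topspace X" using S by blast
    have "openin X ({x \<in> topspace X. q x \<in> S} \<inter> {x \<in> topspace X. q x \<in> S'})"
      using S by (intro openin_Int) simp_all
    also have "{x \<in> topspace X. q x \<in> S} \<inter> {x \<in> topspace X. q x \<in> S'} =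
        {x \<in> topspace X. q x \<in> S \<inter> S'}" by blast
    finally show "openin X {x \<in> topspace X. q x \<in> S \<inter> S'}" .
  next
    fix K assume K: "\<forall>S\<in>K. ?P S"
    show "\<Union>K \<subseteq> q ` topspace X" using K by blast
    have "{x \<in> topspace X. q x \<in> \<Union>K} = (\<Union>S\<in>K. {x \<in> topspace X. q x \<in> S})" by blast
    moreover have "openin X (\<Union>S\<in>K. {x \<in> topspace X. q x \<in> S})"
      using K by (intro openin_Union) auto
    ultimately show "openin X {x \<in> topspace X. q x \<in> \<Union>K}" by simp
  qed
  then show ?thesis
    unfolding final_topology_def by (simp add: topology_inverse')
qed

lemma quotient_map_final_topology: "quotient_map X (final_topology X q) q"
proof -
  have "{x \<in> topspace X. q x \<in> q ` topspace X} = topspace X" by blast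
  then have "openin (final_topology X q) (q ` topspace X)"
    unfolding openin_final_topology by simp
  then have "topspace (final_topology X q) = q ` topspace X"
    by (meson openin_final_topology openin_subset openin_topspace subset_antisym)
  then show ?thesis
    unfolding quotient_map_def openin_final_topology by auto
qed

lemma openin_prod_topologyE:
  assumes "openin (prod_topology X Y) S" and "(x, y) \<in> S"
  obtains U V where "openin X U" "openin Y V" "x \<in> U" "y \<in> V" "U \<times> V \<subseteq> S"
  using assms(1)[unfolded openin_prod_topology_alt, rule_format, OF assms(2)] that by blast

section \<open>Induced actions\<close>

locale induced_action =
  fixes G :: "('a, 'b) monoid_scheme" (structure)
    and T :: "'a topology" and H :: "'a set" and X :: "'x topology" and \<phi> :: "'a \<Rightarrow> 'x \<Rightarrow> 'x"
  assumes topological_group: "topological_group G T"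
    and normal: "H \<lhd> G" and closed: "closedin T H" and cocompact: "cocompact G T H"
    and compact: "compact_space X" and Hausdorff: "Hausdorff_space X"
    and nonempty: "topspace X \<noteq> {}"
    and action: "continuous_action (G\<lparr>carrier := H\<rparr>) (subtopology T H) X \<phi>"
begin

sublocale group G using topological_group by (simp add: topological_group_def)

sublocale H: normal H G by (rule normal)

lemma topspace_T [simp]: "topspace T = carrier G"
  using topological_group by (simp add: topological_group_def)

lemma continuous_mult:
  assumes "continuous_map Z T f" "continuous_map Z T g"
  shows "continuous_map Z T (\<lambda>z. f z \<otimes> g z)"
proof -
  have "continuous_map (prod_topology T T) T (\<lambda>(x, y). x \<otimes> y)"
    using topological_group by (simp add: topological_group_def)
  moreover have "continuous_map Z (prod_topology T T) (\<lambda>z. (f z, g z))"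
    using assms by (simp add: continuous_map_paired)
  ultimately have "continuous_map Z T ((\<lambda>(x, y). x \<otimes> y) \<circ> (\<lambda>z. (f z, g z)))"
    by (rule continuous_map_compose[rotated])
  then show ?thesis by (simp add: o_def)
qed

lemma continuous_inv:
  assumes "continuous_map Z T f"
  shows "continuous_map Z T (\<lambda>z. inv (f z))"
  using continuous_map_compose[OF assms, of T "\<lambda>x. inv x"] topological_group
  by (simp add: topological_group_def o_def)

text \<open>Phrased for maps into \<open>T\<close> with values in \<open>H\<close>, so that later
  continuity arguments stay in the topology of the whole group.\<close>

lemma continuous_action:
  assumes "continuous_map Z T f" "f ` topspace Z \<subseteq> H" "continuous_map Z X g"
  shows "continuous_map Z X (\<lambda>z. \<phi> (f z) (g z))"
proof -
  have "continuous_map (prod_topology (subtopology T H) X) X (\<lambda>(h, x). \<phi> h x)"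
    using action by (simp add: continuous_action_def)
  moreover have "continuous_map Z (prod_topology (subtopology T H) X) (\<lambda>z. (f z, g z))"
    using assms by (simp add: continuous_map_paired continuous_map_in_subtopology image_subset_iff_funcset)
  ultimately have "continuous_map Z X ((\<lambda>(h, x). \<phi> h x) \<circ> (\<lambda>z. (f z, g z)))"
    by (rule continuous_map_compose[rotated])
  then show ?thesis by (simp add: o_def)
qed

interpretation action: group_action "G\<lparr>carrier := H\<rparr>" "topspace X" \<phi>
  using action by (simp add: continuous_action_def)

lemma action_closed [simp]: "h \<in> H \<Longrightarrow> x \<in> topspace X \<Longrightarrow> \<phi> h x \<in> topspace X"
  using action.element_image by simp

lemma action_one [simp]: "x \<in> topspace X \<Longrightarrow> \<phi> \<one> x = x"
  using fun_cong[OF action.id_eq_one, of x] by simp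

lemma action_mult:
  "g \<in> H \<Longrightarrow> h \<in> H \<Longrightarrow> x \<in> topspace X \<Longrightarrow> \<phi> (g \<otimes> h) x = \<phi> g (\<phi> h x)"
  using action.composition_rule by simp

lemma continuous_action_map: "h \<in> H \<Longrightarrow> continuous_map X X (\<phi> h)"
  using continuous_action[of X "\<lambda>_. h" id] by (simp add: eta_contract_eq H.mem_carrier image_subset_iff)

section \<open>The orbit space of the twisted action of \<open>H\<close> on the product of
  \<open>G\<close> and \<open>X\<close>\<close>

definition twist :: "'a \<Rightarrow> 'a \<times> 'x \<Rightarrow> 'a \<times> 'x" where
  "twist h z = (fst z \<otimes> inv h, \<phi> h (snd z))"

text \<open>The orbit of \<open>z\<close> under \<open>twist\<close>, which is a left action of
  \<open>H\<close> thanks to the inverse in its first coordinate. Points of the induced space are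
  these orbits.\<close>

definition cls :: "'a \<times> 'x \<Rightarrow> ('a \<times> 'x) set" where
  "cls z = (\<lambda>h. twist h z) ` H"

definition induced_space :: "('a \<times> 'x) set topology" where
  "induced_space = final_topology (prod_topology T X) cls"

lemma twist_mult:
  "g \<in> H \<Longrightarrow> h \<in> H \<Longrightarrow> z \<in> carrier G \<times> topspace X \<Longrightarrow> twist (g \<otimes> h) z = twist g (twist h z)"
  by (auto simp: twist_def action_mult inv_mult_group m_assoc)

lemma twist_one: "z \<in> carrier G \<times> topspace X \<Longrightarrow> twist \<one> z = z"
  by (auto simp: twist_def)

lemma cls_twist:
  assumes h: "h \<in> H" and z: "z \<in> carrier G \<times> topspace X"
  shows "cls (twist h z) = cls z"
proof -
  have "cls (twist h z) = (\<lambda>g. twist g z) ` (\<lambda>g. g \<otimes> h) ` H"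
    using h z by (auto simp: cls_def twist_mult image_image)
  also have "(\<lambda>g. g \<otimes> h) ` H = H"
  proof -
    have "g \<in> (\<lambda>g. g \<otimes> h) ` H" if "g \<in> H" for g
      using that h by (intro image_eqI[of _ _ "g \<otimes> inv h"]) (auto simp: m_assoc)
    then show ?thesis using h by auto
  qed
  finally show ?thesis by (simp add: cls_def)
qed

lemma self_in_cls: "z \<in> carrier G \<times> topspace X \<Longrightarrow> z \<in> cls z"
  unfolding cls_def by (rule image_eqI[of _ _ \<one>]) (auto simp: twist_one)

lemma cls_eq_iff_twist:
  assumes "z \<in> carrier G \<times> topspace X" "z' \<in> carrier G \<times> topspace X"
  shows "cls z = cls z' \<longleftrightarrow> (\<exists>h\<in>H. z' = twist h z)"
proof
  assume "cls z = cls z'"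
  then have "z' \<in> cls z" using self_in_cls[OF assms(2)] by simp
  then show "\<exists>h\<in>H. z' = twist h z" by (auto simp: cls_def)
qed (use assms cls_twist in auto)

text \<open>The group element relating two representatives is forced by their first coordinates to
  be \<open>inv b \<otimes> a\<close>. This removes the existential quantifier and turns equivalence
  into a condition that can be seen to be closed.\<close>

lemma cls_eq_iff:
  assumes "a \<in> carrier G" "x \<in> topspace X" "b \<in> carrier G" "y \<in> topspace X"
  shows "cls (a, x) = cls (b, y) \<longleftrightarrow> inv b \<otimes> a \<in> H \<and> \<phi> (inv b \<otimes> a) x = y"
proof -
  have "b = a \<otimes> inv h \<longleftrightarrow> h = inv b \<otimes> a" if "h \<in> carrier G" for h
    using assms that by (metis inv_closed inv_equality inv_inv inv_solve_left inv_solve_right m_closed)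
  then have "(\<exists>h\<in>H. (b, y) = twist h (a, x)) \<longleftrightarrow> (\<exists>h\<in>H. h = inv b \<otimes> a \<and> y = \<phi> h x)"
    by (auto simp: twist_def)
  then show ?thesis using assms by (subst cls_eq_iff_twist) auto
qed

lemma quotient_map_cls: "quotient_map (prod_topology T X) induced_space cls"
  unfolding induced_space_def by (rule quotient_map_final_topology)

lemma topspace_induced: "topspace induced_space = cls ` (carrier G \<times> topspace X)"
  using quotient_imp_surjective_map[OF quotient_map_cls] by simp

lemma continuous_cls: "continuous_map (prod_topology T X) induced_space cls"
  by (rule quotient_imp_continuous_map[OF quotient_map_cls])

lemma cls_in_induced [simp]: "a \<in> carrier G \<Longrightarrow> x \<in> topspace X \<Longrightarrow> cls (a, x) \<in> topspace induced_space"
  by (simp add: topspace_induced)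

lemma inducedE:
  assumes "y \<in> topspace induced_space"
  obtains a x where "a \<in> carrier G" "x \<in> topspace X" "y = cls (a, x)"
  using assms by (auto simp: topspace_induced)

lemma openin_induced:
  "openin induced_space W \<longleftrightarrow> W \<subseteq> topspace induced_space \<and>
     openin (prod_topology T X) {z \<in> carrier G \<times> topspace X. cls z \<in> W}"
  by (simp add: induced_space_def openin_final_topology) (simp add: topspace_induced flip: induced_space_def)

lemma continuous_twist:
  assumes "h \<in> H"
  shows "continuous_map (prod_topology T X) (prod_topology T X) (twist h)"
proof -
  have "continuous_map (prod_topology T X) T (\<lambda>z. fst z \<otimes> inv h)"
    using assms by (intro continuous_mult continuous_map_fst) (simp add: H.mem_carrier)
  moreover have "continuous_map (prod_topology T X) X (\<lambda>z. \<phi> h (snd z))"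
    using assms by (intro continuous_action continuous_map_snd) (auto simp: H.mem_carrier)
  ultimately show ?thesis by (simp add: continuous_map_pairwise twist_def[abs_def] o_def)
qed

lemma open_map_cls:
  assumes N: "openin (prod_topology T X) N"
  shows "openin induced_space (cls ` N)"
proof -
  have sub: "N \<subseteq> carrier G \<times> topspace X" using openin_subset[OF N] by simp
  have "{z \<in> carrier G \<times> topspace X. cls z \<in> cls ` N} =
      (\<Union>h\<in>H. {z \<in> topspace (prod_topology T X). twist h z \<in> N})"
    (is "?L = ?R")
  proof (rule Set.set_eqI)
    fix z
    have "cls z \<in> cls ` N \<longleftrightarrow> (\<exists>h\<in>H. twist h z \<in> N)" if z: "z \<in> carrier G \<times> topspace X"
    proof
      assume "cls z \<in> cls ` N"
      then obtain n where "n \<in> N" "cls z = cls n" by blast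
      then show "\<exists>h\<in>H. twist h z \<in> N" using z sub cls_eq_iff_twist[of z n] by blast
    next
      assume "\<exists>h\<in>H. twist h z \<in> N"
      then show "cls z \<in> cls ` N" using z cls_twist by (metis imageI)
    qed
    then show "z \<in> ?L \<longleftrightarrow> z \<in> ?R" by auto
  qed
  moreover have "openin (prod_topology T X) \<dots>"
    using openin_continuous_map_preimage[OF continuous_twist N] by blast
  ultimately show ?thesis
    using sub by (auto simp: openin_induced topspace_induced)
qed

text \<open>An open quotient by an equivalence relation that is closed in the product is Hausdorff.
  Closedness of the relation uses that \<open>H\<close> is closed and that \<open>X\<close> is
  Hausdorff.\<close>

lemma Hausdorff_induced: "Hausdorff_space induced_space"
  unfolding Hausdorff_space_def
proof (intro allI impI)
  fix y y' assume yy: "y \<in> topspace induced_space \<and> y' \<in> topspace induced_space \<and> y \<noteq> y'"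
  then obtain z z' where z: "z \<in> carrier G \<times> topspace X" "z' \<in> carrier G \<times> topspace X"
    "y = cls z" "y' = cls z'" by (auto simp: topspace_induced)
  define PP where "PP = prod_topology (prod_topology T X) (prod_topology T X)"
  \<comment> \<open>The only element of \<open>G\<close> that can carry the first representative to
    the second, see \<open>cls_eq_iff\<close>.\<close>
  define d where "d p = inv (fst (snd p)) \<otimes> fst (fst p)" for p :: "('a \<times> 'x) \<times> 'a \<times> 'x"
  have proj: "continuous_map PP T (\<lambda>p. fst (fst p))" "continuous_map PP X (\<lambda>p. snd (fst p))"
    "continuous_map PP T (\<lambda>p. fst (snd p))" "continuous_map PP X (\<lambda>p. snd (snd p))"
    unfolding PP_def
    by (simp_all add: continuous_map_compose[OF continuous_map_fst continuous_map_fst, unfolded o_def]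
        continuous_map_compose[OF continuous_map_fst continuous_map_snd, unfolded o_def]
        continuous_map_compose[OF continuous_map_snd continuous_map_fst, unfolded o_def]
        continuous_map_compose[OF continuous_map_snd continuous_map_snd, unfolded o_def])
  have d: "continuous_map PP T d"
    unfolding d_def by (intro continuous_mult continuous_inv proj)
  define S where "S = {p \<in> topspace PP. d p \<in> H}"
  have S: "closedin PP S" unfolding S_def by (rule closedin_continuous_map_preimage[OF d closed])
  \<comment> \<open>The action makes sense only where \<open>d p\<close> is in \<open>H\<close>, so
    the equation is studied on \<open>S\<close>. Since \<open>S\<close> is closed, a closed subset
    of \<open>S\<close> is closed in the whole product.\<close>
  have "continuous_map (subtopology PP S) X (\<lambda>p. \<phi> (d p) (snd (fst p)))"
  proof (rule continuous_action)
    show "continuous_map (subtopology PP S) T d" using d continuous_map_from_subtopology by blast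
    show "d ` topspace (subtopology PP S) \<subseteq> H" by (auto simp: S_def)
    show "continuous_map (subtopology PP S) X (\<lambda>p. snd (fst p))"
      by (intro continuous_map_from_subtopology proj)
  qed
  moreover have "continuous_map (subtopology PP S) X (\<lambda>p. snd (snd p))"
    by (intro continuous_map_from_subtopology proj)
  ultimately have "closedin (subtopology PP S)
      {p \<in> topspace (subtopology PP S). \<phi> (d p) (snd (fst p)) = snd (snd p)}"
    using Hausdorff by (intro closedin_continuous_maps_eq)
  then have "closedin PP {p \<in> topspace (subtopology PP S). \<phi> (d p) (snd (fst p)) = snd (snd p)}"
    using S closedin_trans_full by blast
  moreover have "{p \<in> topspace (subtopology PP S). \<phi> (d p) (snd (fst p)) = snd (snd p)} =
      {p \<in> topspace PP. cls (fst p) = cls (snd p)}"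
  proof (rule Collect_cong)
    fix p :: "('a \<times> 'x) \<times> 'a \<times> 'x"
    obtain a x b y where p: "p = ((a, x), b, y)" by (cases p; cases "fst p"; cases "snd p") auto
    show "p \<in> topspace (subtopology PP S) \<and> \<phi> (d p) (snd (fst p)) = snd (snd p) \<longleftrightarrow>
        p \<in> topspace PP \<and> cls (fst p) = cls (snd p)"
    proof (cases "p \<in> topspace PP")
      case True
      then show ?thesis by (simp add: p S_def PP_def d_def cls_eq_iff)
    qed (simp add: S_def)
  qed
  ultimately have "closedin PP {p \<in> topspace PP. cls (fst p) = cls (snd p)}" by simp
  then have "openin PP (topspace PP - {p \<in> topspace PP. cls (fst p) = cls (snd p)})"
    by (simp only: openin_diff[OF openin_topspace])
  moreover have "(z, z') \<in> topspace PP - {p \<in> topspace PP. cls (fst p) = cls (snd p)}"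
    using z(1,2) yy unfolding z(3,4) by (simp add: PP_def)
  \<comment> \<open>The two sides of an open box that misses the relation have disjoint images, and
    these are open because \<open>cls\<close> is an open map.\<close>
  ultimately obtain A B where AB: "openin (prod_topology T X) A" "openin (prod_topology T X) B"
    "z \<in> A" "z' \<in> B" "A \<times> B \<subseteq> topspace PP - {p \<in> topspace PP. cls (fst p) = cls (snd p)}"
    unfolding PP_def by (rule openin_prod_topologyE)
  then have "disjnt (cls ` A) (cls ` B)"
  proof -
    have "cls a \<noteq> cls b" if "a \<in> A" "b \<in> B" for a b
      using subsetD[OF AB(5), of "(a, b)"] that by auto
    then show ?thesis unfolding disjnt_iff by blast
  qed
  then show "\<exists>U V. openin induced_space U \<and> openin induced_space V \<and> y \<in> U \<and> y' \<in> V \<and> disjnt U V"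
    using AB(3,4) z open_map_cls[OF AB(1)] open_map_cls[OF AB(2)] by blast
qed

section \<open>Saturated open sets, strips and compactness of the induced space\<close>

definition saturated :: "'a set \<Rightarrow> bool" where
  "saturated U \<longleftrightarrow> openin T U \<and> (\<forall>u\<in>U. \<forall>h\<in>H. u \<otimes> h \<in> U)"

text \<open>A saturated \<open>U\<close> is the preimage in \<open>G\<close> of an open subset of
  \<open>G/H\<close>, and \<open>strip U\<close> is the preimage of the same subset under the
  projection of \<open>cls (a, x)\<close> to \<open>a <# H\<close>. Open subsets of the base are
  thus handled as subsets of \<open>G\<close>.\<close>

definition strip :: "'a set \<Rightarrow> ('a \<times> 'x) set set" where
  "strip U = cls ` (U \<times> topspace X)"

lemma openin_strip: "saturated U \<Longrightarrow> openin induced_space (strip U)"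
  unfolding strip_def saturated_def by (intro open_map_cls) (simp add: openin_prod_Times_iff)

text \<open>First coordinates of two representatives differ by right multiplication with an element
  of \<open>H\<close>, which saturation absorbs.\<close>

lemma cls_in_strip_iff:
  assumes "saturated U" "a \<in> carrier G" "x \<in> topspace X"
  shows "cls (a, x) \<in> strip U \<longleftrightarrow> a \<in> U"
proof
  assume "cls (a, x) \<in> strip U"
  then obtain u y where u: "u \<in> U" "y \<in> topspace X" "cls (u, y) = cls (a, x)" by (auto simp: strip_def)
  then have uc: "u \<in> carrier G" using assms openin_subset by (fastforce simp: saturated_def)
  then have "inv a \<otimes> u \<in> H" using u assms by (simp add: cls_eq_iff)
  then have "u \<otimes> inv (inv a \<otimes> u) \<in> U" using assms u H.m_inv_closed by (auto simp: saturated_def)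
  moreover have "u \<otimes> inv (inv a \<otimes> u) = a" using uc assms by (simp add: inv_mult_group flip: m_assoc)
  ultimately show "a \<in> U" by simp
qed (use assms in \<open>auto simp: strip_def\<close>)

text \<open>The tube lemma for the projection to \<open>G/H\<close>, valid because the fibre is a
  copy of the compact space \<open>X\<close>: an open set containing a whole fibre contains all
  fibres over a neighbourhood.\<close>

lemma tube:
  assumes W: "openin induced_space W" and a: "a \<in> carrier G" and sub: "\<And>x. x \<in> topspace X \<Longrightarrow> cls (a, x) \<in> W"
  obtains U where "saturated U" "a \<in> U" "strip U \<subseteq> W"
proof -
  have "openin (prod_topology T X) {z \<in> carrier G \<times> topspace X. cls z \<in> W}"
    using W by (simp add: openin_induced)
  moreover have "compactin X (topspace X)" using compact by (simp add: compact_space_def)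
  moreover have "a \<in> topspace T" using a by simp
  moreover have "{a} \<times> topspace X \<subseteq> {z \<in> carrier G \<times> topspace X. cls z \<in> W}"
    using a sub by auto
  ultimately have "\<exists>U V. openin T U \<and> openin X V \<and> a \<in> U \<and> topspace X \<subseteq> V \<and>
      U \<times> V \<subseteq> {z \<in> carrier G \<times> topspace X. cls z \<in> W}"
    by (rule tube_lemma_right)
  then obtain U0 V where U0: "openin T U0" "a \<in> U0" "topspace X \<subseteq> V"
    "U0 \<times> V \<subseteq> {z \<in> carrier G \<times> topspace X. cls z \<in> W}"
    by blast
  \<comment> \<open>The product of \<open>U0\<close> with \<open>H\<close> on the right, the
    smallest saturated set containing \<open>U0\<close>.\<close>
  define U where "U = (\<Union>h\<in>H. {u \<in> topspace T. u \<otimes> h \<in> U0})"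
  have "openin T {u \<in> topspace T. u \<otimes> h \<in> U0}" if "h \<in> H" for h
    using that U0
    by (intro openin_continuous_map_preimage[where Y = T] continuous_mult) (auto simp: H.mem_carrier)
  then have "openin T U" unfolding U_def by blast
  moreover have "u \<otimes> k \<in> U" if u: "u \<in> U" and k: "k \<in> H" for u k
  proof -
    obtain h where h: "h \<in> H" "u \<in> carrier G" "u \<otimes> h \<in> U0" using u by (auto simp: U_def)
    have "k \<otimes> (inv k \<otimes> h) = h" using h k by (simp flip: m_assoc)
    then have "u \<otimes> k \<otimes> (inv k \<otimes> h) = u \<otimes> h" using h k by (simp add: m_assoc)
    then show ?thesis using h k unfolding U_def by (intro UN_I[of "inv k \<otimes> h"]) auto
  qed
  ultimately have "saturated U" by (simp add: saturated_def)
  moreover have "a \<in> U" using U0 a by (auto simp: U_def intro!: bexI[of _ \<one>])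
  moreover have "strip U \<subseteq> W"
  proof
    fix y assume "y \<in> strip U"
    then obtain u h x where u: "h \<in> H" "u \<in> carrier G" "u \<otimes> h \<in> U0" "x \<in> topspace X" "y = cls (u, x)"
      by (auto simp: strip_def U_def)
    \<comment> \<open>Another representative of the same point: its first coordinate lies in
      \<open>U0\<close>, and its second stays in \<open>V\<close> because \<open>V\<close> contains
      all of \<open>X\<close>.\<close>
    then have "(u \<otimes> h, \<phi> (inv h) x) \<in> U0 \<times> V" using U0(3) by auto
    then have "cls (u \<otimes> h, \<phi> (inv h) x) \<in> W" using U0(4) by auto
    moreover have "cls (u \<otimes> h, \<phi> (inv h) x) = cls (u, x)"
      using cls_twist[of "inv h" "(u, x)"] u by (simp add: twist_def)
    ultimately show "y \<in> W" using u by simp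
  qed
  ultimately show thesis by (rule that)
qed

lemma lcoset_mem_iff:
  assumes "saturated U" "a \<in> carrier G"
  shows "a <# H \<in> (\<lambda>u. u <# H) ` U \<longleftrightarrow> a \<in> U"
proof
  assume "a <# H \<in> (\<lambda>u. u <# H) ` U"
  then obtain u where u: "u \<in> U" "a <# H = u <# H" by blast
  then have "a \<in> u <# H" using lcos_self[OF assms(2) H.subgroup_axioms] by simp
  then show "a \<in> U" using u assms by (auto simp: l_coset_def saturated_def)
qed auto

text \<open>Compactness of \<open>G/H\<close> restated inside \<open>G\<close>. The coset images of
  saturated sets are open in the quotient, since each saturated set is the full preimage of its
  image.\<close>

lemma saturated_cover:
  assumes "\<And>a. a \<in> carrier G \<Longrightarrow> saturated (U a) \<and> a \<in> U a"
  obtains F where "finite F" "F \<subseteq> carrier G" "carrier G \<subseteq> (\<Union>a\<in>F. U a)"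
proof -
  define C where "C a = (\<lambda>u. u <# H) ` U a" for a
  let ?Q = "coset_topology G T H"
  have Usub: "U a \<subseteq> carrier G" if "a \<in> carrier G" for a
    using assms[OF that] openin_subset by (fastforce simp: saturated_def)
  have C: "openin ?Q (C a)" if "a \<in> carrier G" for a
  proof -
    have "{x \<in> topspace T. x <# H \<in> C a} = U a"
      using assms[OF that] lcoset_mem_iff Usub[OF that] by (auto simp: C_def)
    then show ?thesis
      using assms[OF that] Usub[OF that] unfolding openin_coset_topology
      by (auto simp: C_def LCOSETS_def saturated_def)
  qed
  have "topspace ?Q = (\<lambda>a. a <# H) ` carrier G"
    using quotient_imp_surjective_map[OF quotient_map_coset_topology[of T G H]] by simp
  then have "topspace ?Q \<subseteq> \<Union>(C ` carrier G)" using assms by (auto simp: C_def)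
  then obtain \<F> where "finite \<F>" "\<F> \<subseteq> C ` carrier G" "topspace ?Q \<subseteq> \<Union>\<F>"
    using cocompact compactinD[of ?Q "topspace ?Q" "C ` carrier G"] C
    unfolding cocompact_def compact_space_def by blast
  then obtain F where F: "finite F" "F \<subseteq> carrier G" "topspace ?Q \<subseteq> \<Union>(C ` F)"
    by (metis finite_subset_image)
  have "a \<in> (\<Union>a\<in>F. U a)" if a: "a \<in> carrier G" for a
  proof -
    obtain b where "b \<in> F" "a <# H \<in> C b" using a F \<open>topspace ?Q = _\<close> by blast
    then show ?thesis using lcoset_mem_iff[of "U b" a] assms a F by (auto simp: C_def)
  qed
  then show thesis by (intro that[OF F(1,2)] subsetI)
qed

text \<open>Each fibre is a continuous image of \<open>X\<close>, so finitely many sets of the cover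
  contain it, and by \<open>tube\<close> they contain a strip around it. Cocompactness leaves
  finitely many strips.\<close>

lemma compact_induced: "compact_space induced_space"
  unfolding compact_space_def compactin_def
proof (intro conjI allI impI)
  fix \<W> assume W: "Ball \<W> (openin induced_space) \<and> topspace induced_space \<subseteq> \<Union>\<W>"
  have "\<exists>\<F> U. finite \<F> \<and> \<F> \<subseteq> \<W> \<and> saturated U \<and> a \<in> U \<and> strip U \<subseteq> \<Union>\<F>" if a: "a \<in> carrier G" for a
  proof -
    have "continuous_map X induced_space (cls \<circ> (\<lambda>x. (a, x)))"
      using a by (intro continuous_map_compose[OF _ continuous_cls])
        (simp add: continuous_map_pairwise o_def)
    then have "compactin induced_space ((cls \<circ> (\<lambda>x. (a, x))) ` topspace X)"
      using compact image_compactin by (fastforce simp: compact_space_def)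
    moreover have "(cls \<circ> (\<lambda>x. (a, x))) ` topspace X \<subseteq> \<Union>\<W>" using W a by auto
    ultimately obtain \<F> where F: "finite \<F>" "\<F> \<subseteq> \<W>" "(cls \<circ> (\<lambda>x. (a, x))) ` topspace X \<subseteq> \<Union>\<F>"
      using W compactinD by metis
    moreover have "openin induced_space (\<Union>\<F>)" using F(2) W by (intro openin_Union) blast
    then obtain U where "saturated U" "a \<in> U" "strip U \<subseteq> \<Union>\<F>"
      using F(3) by (elim tube[OF _ a]) auto
    ultimately show ?thesis by blast
  qed
  then obtain \<F> U where FU: "\<And>a. a \<in> carrier G \<Longrightarrow>
      finite (\<F> a) \<and> \<F> a \<subseteq> \<W> \<and> saturated (U a) \<and> a \<in> U a \<and> strip (U a) \<subseteq> \<Union>(\<F> a)"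
    by metis
  then obtain F where F: "finite F" "F \<subseteq> carrier G" "carrier G \<subseteq> (\<Union>a\<in>F. U a)"
    using saturated_cover[of U] by metis
  show "\<exists>\<F>. finite \<F> \<and> \<F> \<subseteq> \<W> \<and> topspace induced_space \<subseteq> \<Union>\<F>"
  proof (intro exI[of _ "\<Union>a\<in>F. \<F> a"] conjI)
    show "finite (\<Union>a\<in>F. \<F> a)" "(\<Union>a\<in>F. \<F> a) \<subseteq> \<W>" using F FU by blast+
    show "topspace induced_space \<subseteq> \<Union>(\<Union>a\<in>F. \<F> a)"
    proof
      fix y assume "y \<in> topspace induced_space"
      then obtain a x where a: "a \<in> carrier G" "x \<in> topspace X" "y = cls (a, x)" by (rule inducedE)
      then obtain b where b: "b \<in> F" "a \<in> U b" using F by blast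
      then have "y \<in> strip (U b)" using a by (simp add: strip_def)
      moreover have "strip (U b) \<subseteq> \<Union>(\<F> b)" using FU b(1) F(2) by blast
      ultimately show "y \<in> \<Union>(\<Union>a\<in>F. \<F> a)" using b(1) by blast
    qed
  qed
qed simp

section \<open>The action of \<open>G\<close> by left translation\<close>

definition translate :: "'a \<Rightarrow> ('a \<times> 'x) set \<Rightarrow> ('a \<times> 'x) set" where
  "translate g = (\<lambda>y\<in>topspace induced_space. (\<lambda>z. (g \<otimes> fst z, snd z)) ` y)"

text \<open>Left multiplication by \<open>g\<close> commutes with right multiplication by
  \<open>inv h\<close>, so it carries orbits to orbits.\<close>

lemma translate_cls:
  assumes "g \<in> carrier G" "a \<in> carrier G" "x \<in> topspace X"
  shows "translate g (cls (a, x)) = cls (g \<otimes> a, x)"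
proof -
  have "translate g (cls (a, x)) = (\<lambda>z. (g \<otimes> fst z, snd z)) ` cls (a, x)"
    using assms by (simp add: translate_def)
  also have "\<dots> = cls (g \<otimes> a, x)"
    using assms by (auto simp: cls_def twist_def image_image m_assoc H.mem_carrier intro!: image_cong)
  finally show ?thesis .
qed

text \<open>Joint continuity is the delicate point, since the product of a quotient map with an
  identity map need not be a quotient map. Here \<open>cls\<close> is open, so an open box upstairs
  maps to an open box in the product with the induced space.\<close>

lemma continuous_action_translate: "continuous_action G T induced_space translate"
  unfolding continuous_action_def
proof (intro conjI)
  show "group_action G (topspace induced_space) translate"
  proof (rule group_actionI)
    show "translate g \<in> extensional (topspace induced_space)" for g by (simp add: translate_def)
  qed (auto elim!: inducedE simp: translate_cls m_assoc)
  show "continuous_map (prod_topology T induced_space) induced_space (\<lambda>(g, y). translate g y)"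
    unfolding continuous_map_def
  proof (intro conjI allI impI)
    show "(\<lambda>(g, y). translate g y) \<in> topspace (prod_topology T induced_space) \<rightarrow> topspace induced_space"
      by (auto elim!: inducedE simp: translate_cls)
    fix W assume W: "openin induced_space W"
    let ?W = "{p \<in> topspace (prod_topology T induced_space). (case p of (g, y) \<Rightarrow> translate g y) \<in> W}"
    have "continuous_map (prod_topology T (prod_topology T X)) induced_space
        (cls \<circ> (\<lambda>p. (fst p \<otimes> fst (snd p), snd (snd p))))"
    proof (rule continuous_map_compose[OF _ continuous_cls])
      show "continuous_map (prod_topology T (prod_topology T X)) (prod_topology T X)
          (\<lambda>p. (fst p \<otimes> fst (snd p), snd (snd p)))"
        by (simp add: continuous_map_paired continuous_mult continuous_map_fst
            continuous_map_compose[OF continuous_map_snd continuous_map_fst, unfolded o_def]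
            continuous_map_compose[OF continuous_map_snd continuous_map_snd, unfolded o_def])
    qed
    from openin_continuous_map_preimage[OF this W]
    have op: "openin (prod_topology T (prod_topology T X))
        {p \<in> carrier G \<times> carrier G \<times> topspace X. cls (fst p \<otimes> fst (snd p), snd (snd p)) \<in> W}"
      by simp
    show "openin (prod_topology T induced_space) ?W"
      unfolding openin_prod_topology_alt
    proof (intro allI impI)
      fix g y assume "(g, y) \<in> ?W"
      then have g: "g \<in> carrier G" "y \<in> topspace induced_space" "translate g y \<in> W" by auto
      then obtain a x where a: "a \<in> carrier G" "x \<in> topspace X" "y = cls (a, x)" by (auto elim: inducedE)
      then have "(g, a, x) \<in>
          {p \<in> carrier G \<times> carrier G \<times> topspace X. cls (fst p \<otimes> fst (snd p), snd (snd p)) \<in> W}"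
        using g by (simp add: translate_cls)
      with op obtain A N where AN: "openin T A" "openin (prod_topology T X) N" "g \<in> A" "(a, x) \<in> N"
        "A \<times> N \<subseteq> {p \<in> carrier G \<times> carrier G \<times> topspace X. cls (fst p \<otimes> fst (snd p), snd (snd p)) \<in> W}"
        by (rule openin_prod_topologyE)
      have "A \<times> cls ` N \<subseteq> ?W"
      proof clarify
        fix g' b x' assume "g' \<in> A" "(b, x') \<in> N"
        then have "g' \<in> carrier G" "b \<in> carrier G" "x' \<in> topspace X" "cls (g' \<otimes> b, x') \<in> W"
          using AN(5) by auto
        then show "(g', cls (b, x')) \<in> topspace (prod_topology T induced_space) \<and> translate g' (cls (b, x')) \<in> W"
          by (simp add: translate_cls)
      qed
      then show "\<exists>U V. openin T U \<and> openin induced_space V \<and> g \<in> U \<and> y \<in> V \<and> U \<times> V \<subseteq> ?W"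
        using AN(1,3,4) a(3) open_map_cls[OF AN(2)] by blast
    qed
  qed
qed

end

section \<open>Contents from finitely additive means\<close>

text \<open>Infima over open neighbourhoods turn a finitely additive mean on \<open>Y\<close>,
  concentrated near the embedded copy of \<open>X\<close>, into a content on \<open>X\<close>.
  Disjoint closed sets have disjoint compact images, which disjoint open sets separate; this gives
  superadditivity.\<close>

lemma normalized_content_of_mean:
  fixes X :: "'x topology" and Y :: "'y topology" and m :: "'y set \<Rightarrow> real" and f :: "'x \<Rightarrow> 'y"
  assumes "compact_space X" and X: "Hausdorff_space X" and Y: "Hausdorff_space Y"
    and f: "continuous_map X Y f" and inj: "inj_on f (topspace X)"
    and alg: "algebra (topspace Y) S" and openS: "\<And>W. openin Y W \<Longrightarrow> W \<in> S"
    and nonneg: "\<And>A. A \<in> S \<Longrightarrow> 0 \<le> m A"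
    and add: "\<And>A B. A \<in> S \<Longrightarrow> B \<in> S \<Longrightarrow> A \<inter> B = {} \<Longrightarrow> m (A \<union> B) = m A + m B"
    and one: "\<And>W. openin Y W \<Longrightarrow> f ` topspace X \<subseteq> W \<Longrightarrow> m W = 1"
  shows "normalized_content X (\<lambda>K. INF W\<in>{W. openin Y W \<and> f ` K \<subseteq> W}. ennreal (m W))"
proof
  interpret algebra "topspace Y" S by (rule alg)
  define c where "c K = (INF W\<in>{W. openin Y W \<and> f ` K \<subseteq> W}. ennreal (m W))" for K
  have mono: "m A \<le> m B" if "A \<in> S" "B \<in> S" "A \<subseteq> B" for A B
  proof -
    have "m (A \<union> (B - A)) = m A + m (B - A)" using that by (intro add) auto
    moreover have "A \<union> (B - A) = B" using that by blast
    ultimately show ?thesis using nonneg[of "B - A"] that by auto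
  qed
  have subadd: "m (A \<union> B) \<le> m A + m B" if "A \<in> S" "B \<in> S" for A B
  proof -
    have "m (A \<union> (B - A)) = m A + m (B - A)" using that by (intro add) auto
    moreover have "m (B - A) \<le> m B" using that by (intro mono) auto
    ultimately show ?thesis by simp
  qed
  have c_le: "c K \<le> ennreal (m W)" if "openin Y W" "f ` K \<subseteq> W" for K W
    unfolding c_def by (rule INF_lower) (use that in simp)
  have fY: "f ` K \<subseteq> topspace Y" if "closedin X K" for K
    using continuous_map_image_subset_topspace[OF f] closedin_subset[OF that] by blast
  have c_fin: "c K \<noteq> \<infinity>" if "closedin X K" for K
    using c_le[OF openin_topspace fY[OF that]] by (auto simp: top_unique)
  show "compact_space X" "Hausdorff_space X" by fact+
  fix K L assume K: "closedin X K" and L: "closedin X L"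
  show "c K \<le> c L" if "K \<subseteq> L"
    unfolding c_def using that by (intro INF_superset_mono) auto
  show "c (K \<union> L) \<le> c K + c L"
  proof (rule ennreal_le_epsilon)
    fix e :: real assume e: "0 < e"
    obtain V where V: "openin Y V" "f ` K \<subseteq> V" "ennreal (m V) < c K + ennreal (e / 2)"
      using INF_approx_ennreal[of "e / 2", OF _ c_def[of K] c_fin[OF K]] e by auto
    obtain W where W: "openin Y W" "f ` L \<subseteq> W" "ennreal (m W) < c L + ennreal (e / 2)"
      using INF_approx_ennreal[of "e / 2", OF _ c_def[of L] c_fin[OF L]] e by auto
    have "c (K \<union> L) \<le> ennreal (m (V \<union> W))" using V W by (intro c_le) auto
    also have "\<dots> \<le> ennreal (m V) + ennreal (m W)"
      using subadd[of V W] V W openS nonneg by (simp flip: ennreal_plus)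
    also have "\<dots> \<le> (c K + ennreal (e / 2)) + (c L + ennreal (e / 2))"
      using V W by (intro add_mono) (auto intro: less_imp_le)
    also have "\<dots> = c K + c L + (ennreal (e / 2) + ennreal (e / 2))" by (simp only: ac_simps)
    also have "ennreal (e / 2) + ennreal (e / 2) = ennreal e"
      using e by (simp flip: ennreal_plus)
    finally show "c (K \<union> L) \<le> c K + c L + ennreal e" .
  qed
  show "c K + c L \<le> c (K \<union> L)" if disj: "K \<inter> L = {}"
  proof -
    have "compactin Y (f ` K)" "compactin Y (f ` L)"
      using K L image_compactin[OF closedin_compact_space[OF assms(1)] f] by auto
    moreover have "disjnt (f ` K) (f ` L)"
      using disj inj closedin_subset[OF K] closedin_subset[OF L]
      by (auto simp: disjnt_iff dest!: inj_onD)
    ultimately obtain V W where VW: "openin Y V" "openin Y W" "f ` K \<subseteq> V" "f ` L \<subseteq> W" "disjnt V W"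
      using Hausdorff_space_compact_separation[OF Y] by metis
    show ?thesis
      unfolding c_def[of "K \<union> L"]
    proof (rule INF_greatest, clarify)
      fix U assume U: "openin Y U" "f ` (K \<union> L) \<subseteq> U"
      have disj: "(U \<inter> V) \<inter> (U \<inter> W) = {}" using VW(5) by (auto simp: disjnt_def)
      have S: "U \<inter> V \<in> S" "U \<inter> W \<in> S" "U \<in> S" using U VW openS by auto
      have "c K + c L \<le> ennreal (m (U \<inter> V)) + ennreal (m (U \<inter> W))"
        using U VW by (intro add_mono c_le) auto
      also have "\<dots> = ennreal (m ((U \<inter> V) \<union> (U \<inter> W)))"
        using add[OF S(1,2) disj] nonneg S by (simp flip: ennreal_plus)
      also have "\<dots> \<le> ennreal (m U)" using S by (intro ennreal_leI mono) auto
      finally show "c K + c L \<le> ennreal (m U)" .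
    qed
  qed
next
  have "f ` topspace X \<subseteq> topspace Y" by (rule continuous_map_image_subset_topspace[OF f])
  \<comment> \<open>Nonemptiness matters: an infimum over no sets would be infinite instead of
    1.\<close>
  then have "{W. openin Y W \<and> f ` topspace X \<subseteq> W} \<noteq> {}" by blast
  moreover have "ennreal (m W) = 1" if "W \<in> {W. openin Y W \<and> f ` topspace X \<subseteq> W}" for W
    using one that by simp
  then have "(INF W\<in>{W. openin Y W \<and> f ` topspace X \<subseteq> W}. ennreal (m W)) =
      (INF W\<in>{W. openin Y W \<and> f ` topspace X \<subseteq> W}. 1)"
    by (intro INF_cong refl)
  ultimately show "(INF W\<in>{W. openin Y W \<and> f ` topspace X \<subseteq> W}. ennreal (m W)) = 1"
    by simp
qed

section \<open>Localizing an invariant measure to the identity coset\<close>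

context induced_action
begin

text \<open>The intersection with \<open>carrier G\<close> covers the empty family, whose
  intersection is the whole type.\<close>

lemma saturated_Inter:
  assumes "finite \<U>" "\<And>U. U \<in> \<U> \<Longrightarrow> saturated U"
  shows "saturated (carrier G \<inter> \<Inter>\<U>)"
  using assms
proof (induction \<U> rule: finite_induct)
  case empty
  show ?case using openin_topspace[of T] by (auto simp: saturated_def H.mem_carrier)
next
  case (insert U \<U>)
  then have "saturated U" "saturated (carrier G \<inter> \<Inter>\<U>)" by auto
  then have "saturated (U \<inter> (carrier G \<inter> \<Inter>\<U>))" by (auto simp: saturated_def)
  moreover have "U \<inter> (carrier G \<inter> \<Inter>\<U>) = carrier G \<inter> \<Inter>(insert U \<U>)" by blast
  ultimately show ?case by simp
qed

lemma saturated_subset: "saturated U \<Longrightarrow> U \<subseteq> carrier G"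
  using openin_subset[of T U] by (simp add: saturated_def)

lemma saturated_vimage_mult:
  assumes U: "saturated U" and g: "g \<in> carrier G"
  shows "saturated {x \<in> carrier G. g \<otimes> x \<in> U}"
proof -
  have "openin T {x \<in> topspace T. g \<otimes> x \<in> U}"
    using g U by (intro openin_continuous_map_preimage[where Y = T] continuous_mult)
      (auto simp: saturated_def)
  then show ?thesis
    using U g by (auto simp: saturated_def H.mem_carrier simp flip: m_assoc)
qed

lemma continuous_translate: "g \<in> carrier G \<Longrightarrow> continuous_map induced_space induced_space (translate g)"
  using continuous_action_translate
    continuous_map_compose[of induced_space "prod_topology T induced_space" "\<lambda>y. (g, y)" induced_space "\<lambda>(g, y). translate g y"]
  by (simp add: continuous_action_def continuous_map_paired o_def)

text \<open>Translation covers left multiplication on \<open>G/H\<close>, so a strip pulls back to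
  the strip over the pulled-back base.\<close>

lemma vimage_translate_strip:
  assumes "saturated U" and "g \<in> carrier G"
  shows "translate g -` strip U \<inter> topspace induced_space = strip {x \<in> carrier G. g \<otimes> x \<in> U}"
proof (rule Set.set_eqI)
  fix y
  have "strip {x \<in> carrier G. g \<otimes> x \<in> U} \<subseteq> topspace induced_space"
    using openin_subset[OF openin_strip[OF saturated_vimage_mult[OF assms]]] .
  moreover have "translate g y \<in> strip U \<longleftrightarrow> y \<in> strip {x \<in> carrier G. g \<otimes> x \<in> U}"
    if "y \<in> topspace induced_space"
    using that assms
    by (elim inducedE) (simp add: translate_cls cls_in_strip_iff saturated_vimage_mult)
  ultimately show "y \<in> translate g -` strip U \<inter> topspace induced_space \<longleftrightarrow>
      y \<in> strip {x \<in> carrier G. g \<otimes> x \<in> U}" by blast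
qed

text \<open>Normality of \<open>H\<close> enters here: \<open>h a = a (a\<^sup>-\<^sup>1 h a)\<close> lies in the coset of \<open>a\<close>.\<close>

lemma vimage_translate_strip_normal:
  assumes U: "saturated U" and h: "h \<in> H"
  shows "translate h -` strip U \<inter> topspace induced_space = strip U"
proof -
  have "h \<otimes> x \<in> U \<longleftrightarrow> x \<in> U" if x: "x \<in> carrier G" for x
  proof -
    have *: "g \<otimes> y \<in> U" if g: "g \<in> H" and y: "y \<in> U" for g y
    proof -
      have yG: "y \<in> carrier G" using saturated_subset[OF U] y by blast
      then have "y \<otimes> (inv y \<otimes> g \<otimes> y) \<in> U"
        using U g y H.inv_op_closed1 by (simp add: saturated_def)
      moreover have "y \<otimes> (inv y \<otimes> g \<otimes> y) = g \<otimes> y"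
        using yG g by (simp add: H.mem_carrier flip: m_assoc)
      ultimately show ?thesis by simp
    qed
    have "inv h \<otimes> (h \<otimes> x) = x" using h x by (simp add: H.mem_carrier flip: m_assoc)
    then show ?thesis using *[OF h, of x] *[of "inv h" "h \<otimes> x"] h by auto
  qed
  then have "{x \<in> carrier G. h \<otimes> x \<in> U} = U" using saturated_subset[OF U] by blast
  then show ?thesis using vimage_translate_strip[OF U, of h] h by (simp add: H.mem_carrier)
qed

section \<open>An invariant measure on the induced space, restricted to strips\<close>

context
  fixes N :: "('a \<times> 'x) set measure"
  assumes N: "regular_borel_prob induced_space N" and inv: "invariant_measure G translate N"
begin

interpretation N: prob_space N by (rule regular_borel_probD[OF N])

lemma space_N: "space N = topspace induced_space"
  and sets_N: "sets N = sigma_sets (topspace induced_space) {U. openin induced_space U}"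
  using regular_borel_probD[OF N] by simp_all

lemma open_in_sets_N: "openin induced_space W \<Longrightarrow> W \<in> sets N"
  by (simp add: sets_N sigma_sets.Basic)

lemma strip_in_sets_N: "saturated U \<Longrightarrow> strip U \<in> sets N"
  by (intro open_in_sets_N openin_strip)

lemma translate_measurable: "g \<in> carrier G \<Longrightarrow> translate g \<in> measurable N N"
  by (rule continuous_map_measurable[OF continuous_translate space_N sets_N sets_N])

lemma measure_vimage_translate:
  assumes g: "g \<in> carrier G" and A: "A \<in> sets N"
  shows "measure N (translate g -` A \<inter> topspace induced_space) = measure N A"
proof -
  have "measure (distr N N (translate g)) A = measure N (translate g -` A \<inter> space N)"
    by (rule measure_distr[OF translate_measurable[OF g] A])
  moreover have "distr N N (translate g) = N" using inv g by (simp add: invariant_measure_def)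
  ultimately show ?thesis by (simp add: space_N)
qed

text \<open>By cocompactness finitely many translates of \<open>strip U\<close> cover the space.
  They all have the same measure by invariance, so it cannot be 0.\<close>

lemma measure_strip_pos:
  assumes U: "saturated U" and a: "a \<in> U"
  shows "0 < measure N (strip U)"
proof -
  have aG: "a \<in> carrier G" using saturated_subset[OF U] a by blast
  \<comment> \<open>The left translate of \<open>U\<close> by \<open>b \<otimes> inv a\<close>,
    which moves \<open>a\<close> to \<open>b\<close>.\<close>
  define V where "V b = {x \<in> carrier G. a \<otimes> inv b \<otimes> x \<in> U}" for b
  have V: "saturated (V b) \<and> b \<in> V b" if "b \<in> carrier G" for b
  proof -
    have "a \<otimes> inv b \<otimes> b = a" using that aG by (simp add: m_assoc)
    then show ?thesis
      using saturated_vimage_mult[OF U, of "a \<otimes> inv b"] that aG a by (simp add: V_def)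
  qed
  obtain F where F: "finite F" "F \<subseteq> carrier G" "carrier G \<subseteq> (\<Union>b\<in>F. V b)"
    by (rule saturated_cover[OF V])
  have "topspace induced_space \<subseteq> (\<Union>b\<in>F. strip (V b))"
  proof
    fix y assume "y \<in> topspace induced_space"
    then obtain c x where c: "c \<in> carrier G" "x \<in> topspace X" "y = cls (c, x)" by (rule inducedE)
    then obtain b where "b \<in> F" "c \<in> V b" using F by blast
    then show "y \<in> (\<Union>b\<in>F. strip (V b))" using c by (auto simp: strip_def)
  qed
  moreover have sets: "strip (V b) \<in> sets N" if "b \<in> F" for b
    using that F V strip_in_sets_N by blast
  ultimately have "measure N (space N) \<le> measure N (\<Union>b\<in>F. strip (V b))"
    using F by (intro N.finite_measure_mono) (auto simp: space_N)
  also have "\<dots> \<le> (\<Sum>b\<in>F. measure N (strip (V b)))"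
    using F sets by (intro N.finite_measure_subadditive_finite) auto
  also have "\<dots> = (\<Sum>b\<in>F. measure N (strip U))"
  proof (rule sum.cong[OF refl])
    fix b assume "b \<in> F"
    then have g: "a \<otimes> inv b \<in> carrier G" using F aG by auto
    show "measure N (strip (V b)) = measure N (strip U)"
      using measure_vimage_translate[OF g strip_in_sets_N[OF U]]
      by (simp add: vimage_translate_strip[OF U g] V_def)
  qed
  finally have "1 \<le> card F * measure N (strip U)" by (simp add: N.prob_space)
  then show ?thesis by (cases "measure N (strip U) = 0") (auto simp: zero_less_measure_iff)
qed

text \<open>The mean is a cluster point of the conditional measures of \<open>N\<close> on the strips around \<open>H\<close>.\<close>

lemma localized_mean:
  obtains m :: "('a \<times> 'x) set set \<Rightarrow> real"
  where "\<And>A. 0 \<le> m A" and "\<And>A. m A \<le> 1"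
    and "\<And>A B. A \<in> sets N \<Longrightarrow> B \<in> sets N \<Longrightarrow> A \<inter> B = {} \<Longrightarrow> m (A \<union> B) = m A + m B"
    and "\<And>h A. h \<in> H \<Longrightarrow> A \<in> sets N \<Longrightarrow> m (translate h -` A \<inter> topspace induced_space) = m A"
    and "\<And>U. saturated U \<Longrightarrow> \<one> \<in> U \<Longrightarrow> m (strip U) = 1"
proof -
  let ?I = "{U. saturated U \<and> \<one> \<in> U}"
  \<comment> \<open>Each condition on \<open>m\<close> involves finitely many of its values, so
    \<open>D U\<close> is closed in the product topology. The functions into \<open>{0..1}\<close>
    form a compact cube, so it is enough to meet any finitely many of the
    \<open>D U\<close>.\<close>
  define D where "D U = {m :: ('a \<times> 'x) set set \<Rightarrow> real.
     (\<forall>A B. A \<in> sets N \<longrightarrow> B \<in> sets N \<longrightarrow> A \<inter> B = {} \<longrightarrow> m (A \<union> B) = m A + m B) \<and>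
     (\<forall>h A. h \<in> H \<longrightarrow> A \<in> sets N \<longrightarrow> m (translate h -` A \<inter> topspace induced_space) = m A) \<and>
     m (strip U) = 1}" for U
  have "Pi\<^sub>E UNIV (\<lambda>_. {0..1}) \<inter> (\<Inter>U\<in>?I. D U) \<noteq> {}"
  proof (rule compact_imp_fip_image)
    have "compactin (product_topology (\<lambda>_. euclidean) UNIV) (Pi\<^sub>E UNIV (\<lambda>_ :: ('a \<times> 'x) set set. {0..1 :: real}))"
      by (simp add: compactin_PiE)
    then show "compact (Pi\<^sub>E UNIV (\<lambda>_ :: ('a \<times> 'x) set set. {0..1 :: real}))"
      by (simp add: euclidean_product_topology)
    show "closed (D U)" for U
      unfolding D_def
      by (intro closed_Collect_conj closed_Collect_all closed_Collect_imp open_Collect_const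
          closed_Collect_eq continuous_on_add continuous_on_const continuous_on_product_coordinates)
    fix J assume J: "finite J" "J \<subseteq> ?I"
    \<comment> \<open>Conditioning on the smallest strip settles all members of \<open>J\<close> at
      once; for empty \<open>J\<close> it is the whole space.\<close>
    define U where "U = carrier G \<inter> \<Inter>J"
    have U: "saturated U" "\<one> \<in> U" using J saturated_Inter[of J] by (auto simp: U_def)
    define m where "m A = measure N (A \<inter> strip U) / measure N (strip U)" for A
    have sU: "strip U \<in> sets N" by (rule strip_in_sets_N[OF U(1)])
    have pos: "0 < measure N (strip U)" by (rule measure_strip_pos[OF U])
    have "0 \<le> m A" "m A \<le> 1" for A
    proof -
      show "0 \<le> m A" by (simp add: m_def)
      \<comment> \<open>The cube constrains \<open>m\<close> on every set, measurable or not; on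
        sets outside \<open>sets N\<close> the measure is 0 by convention.\<close>
      have "measure N (A \<inter> strip U) \<le> measure N (strip U)"
        using sU by (cases "A \<inter> strip U \<in> sets N")
          (auto intro: N.finite_measure_mono simp: measure_notin_sets)
      then show "m A \<le> 1" using pos by (simp add: m_def)
    qed
    moreover have "m (A \<union> B) = m A + m B" if "A \<in> sets N" "B \<in> sets N" "A \<inter> B = {}" for A B
    proof -
      have "measure N ((A \<inter> strip U) \<union> (B \<inter> strip U)) =
          measure N (A \<inter> strip U) + measure N (B \<inter> strip U)"
        using that sU by (intro N.finite_measure_Union) auto
      then show ?thesis by (simp add: m_def Int_Un_distrib2 add_divide_distrib)
    qed
    moreover have "m (translate h -` A \<inter> topspace induced_space) = m A"
      if h: "h \<in> H" and A: "A \<in> sets N" for h A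
    proof -
      \<comment> \<open>The strip is its own preimage under \<open>translate h\<close>, so
        conditioning on it preserves invariance under \<open>H\<close>.\<close>
      have "translate h -` A \<inter> topspace induced_space \<inter> strip U =
          translate h -` (A \<inter> strip U) \<inter> topspace induced_space"
        using vimage_translate_strip_normal[OF U(1) h] by blast
      then show ?thesis
        using measure_vimage_translate[of h "A \<inter> strip U"] h A sU by (simp add: m_def H.mem_carrier)
    qed
    moreover have "m (strip V) = 1" if "V \<in> J" for V
    proof -
      have "strip V \<inter> strip U = strip U" using that by (auto simp: strip_def U_def)
      then show ?thesis using pos by (simp add: m_def)
    qed
    ultimately have "m \<in> Pi\<^sub>E UNIV (\<lambda>_. {0..1}) \<inter> (\<Inter>U\<in>J. D U)"
      by (auto simp: D_def PiE_UNIV_domain)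
    then show "Pi\<^sub>E UNIV (\<lambda>_. {0..1}) \<inter> (\<Inter>U\<in>J. D U) \<noteq> {}" by blast
  qed
  then obtain m where "m \<in> Pi\<^sub>E UNIV (\<lambda>_. {0..1}) \<inter> (\<Inter>U\<in>?I. D U)"
    unfolding ex_in_conv[symmetric] by (rule exE)
  then have m: "m \<in> Pi\<^sub>E UNIV (\<lambda>_. {0..1})" "\<And>U. saturated U \<Longrightarrow> \<one> \<in> U \<Longrightarrow> m \<in> D U"
    by auto
  \<comment> \<open>Additivity and invariance are the same in every \<open>D U\<close>; this member
    supplies them.\<close>
  have "m \<in> D (carrier G)" using m(2)[of "carrier G"] saturated_Inter[of "{}"] by simp
  then show thesis using m by (intro that[of m]) (auto simp: D_def PiE_UNIV_domain Pi_iff)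
qed

lemma invariant_measure_fibre:
  "\<exists>M. regular_borel_prob X M \<and> invariant_measure (G\<lparr>carrier := H\<rparr>) \<phi> M"
proof -
  obtain m :: "('a \<times> 'x) set set \<Rightarrow> real" where m: "\<And>A. 0 \<le> m A" "\<And>A. m A \<le> 1"
    "\<And>A B. A \<in> sets N \<Longrightarrow> B \<in> sets N \<Longrightarrow> A \<inter> B = {} \<Longrightarrow> m (A \<union> B) = m A + m B"
    "\<And>h A. h \<in> H \<Longrightarrow> A \<in> sets N \<Longrightarrow> m (translate h -` A \<inter> topspace induced_space) = m A"
    "\<And>U. saturated U \<Longrightarrow> \<one> \<in> U \<Longrightarrow> m (strip U) = 1"
    by (rule localized_mean) blast
  define f where "f x = cls (\<one>, x)" for x
  define c where "c K = (INF W\<in>{W. openin induced_space W \<and> f ` K \<subseteq> W}. ennreal (m W))" for K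
  have "normalized_content X c"
    unfolding c_def[abs_def]
  proof (rule normalized_content_of_mean)
    show "continuous_map X induced_space f"
      using continuous_map_compose[of X "prod_topology T X" "\<lambda>x. (\<one>, x)" induced_space cls] continuous_cls
      by (simp add: continuous_map_paired f_def[abs_def] o_def)
    show "inj_on f (topspace X)"
      by (rule inj_onI) (simp add: f_def cls_eq_iff)
    show "algebra (topspace induced_space) (sets N)"
      using sets.algebra_axioms[of N] by (simp add: space_N)
    show "m W = 1" if W: "openin induced_space W" "f ` topspace X \<subseteq> W" for W
    proof -
      obtain U where U: "saturated U" "\<one> \<in> U" "strip U \<subseteq> W"
        using W by (elim tube[of W \<one>]) (auto simp: f_def)
      \<comment> \<open>An open set containing the fibre contains a strip of mean 1, and no mean
        exceeds 1.\<close>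
      have "m (strip U \<union> (W - strip U)) = m (strip U) + m (W - strip U)"
        using U W by (intro m(3)) (auto intro: strip_in_sets_N open_in_sets_N)
      moreover have "strip U \<union> (W - strip U) = W" using U by blast
      ultimately show ?thesis using m(1)[of "W - strip U"] m(2)[of W] m(5)[OF U(1,2)] by simp
    qed
  qed (use compact Hausdorff Hausdorff_induced open_in_sets_N m in auto)
  then interpret normalized_content X c .
  have "distr borel_measure borel_measure (\<phi> h) = borel_measure" if h: "h \<in> H" for h
  proof (rule distr_borel_measure[OF continuous_action_map[OF h]])
    fix K assume K: "closedin X K"
    show "c K \<le> c (\<phi> h ` K)"
      unfolding c_def[of "\<phi> h ` K"]
    proof (rule INF_greatest, clarify)
      fix W assume W: "openin induced_space W" "f ` \<phi> h ` K \<subseteq> W"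
      define V where "V = translate h -` W \<inter> topspace induced_space"
      have hG: "h \<in> carrier G" using h by (rule H.mem_carrier)
      have "V = {y \<in> topspace induced_space. translate h y \<in> W}" by (auto simp: V_def)
      then have "openin induced_space V"
        using openin_continuous_map_preimage[OF continuous_translate[OF hG] W(1)] by simp
      moreover have "f ` K \<subseteq> V"
      proof clarify
        fix x assume x: "x \<in> K"
        then have xX: "x \<in> topspace X" using closedin_subset[OF K] by blast
        have "translate h (f x) = cls (h, x)" using hG xX by (simp add: f_def translate_cls)
        \<comment> \<open>Twisting \<open>(h, x)\<close> by \<open>h\<close> returns the first
          coordinate to \<open>\<one>\<close> and applies \<open>\<phi> h\<close> to the
          second.\<close>
        also have "\<dots> = f (\<phi> h x)"
          using cls_twist[of h "(h, x)"] h hG xX by (simp add: f_def twist_def)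
        finally show "f x \<in> V" using W(2) x xX by (auto simp: V_def f_def)
      qed
      ultimately have "c K \<le> ennreal (m V)" unfolding c_def by (intro INF_lower) simp
      also have "m V = m W" unfolding V_def using h open_in_sets_N[OF W(1)] by (rule m(4))
      finally show "c K \<le> ennreal (m W)" .
    qed
  qed
  then show ?thesis
    using regular_borel_prob_borel_measure by (auto simp: invariant_measure_def)
qed

end

text \<open>The induced space consists of sets of pairs, so amenability is applied through
  \<open>amenable_invariant_measure\<close>, which admits compact spaces over any type.\<close>

lemma exists_invariant_measure:
  assumes "amenable G T"
  shows "\<exists>M. regular_borel_prob X M \<and> invariant_measure (G\<lparr>carrier := H\<rparr>) \<phi> M"
proof -
  have "topspace induced_space \<noteq> {}" using nonempty by (auto simp: topspace_induced)
  then show ?thesis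
    using amenable_invariant_measure[OF assms compact_induced Hausdorff_induced _ continuous_action_translate]
      invariant_measure_fibre by blast
qed

end

section \<open>Subgroups with the induced topology, and the conclusion\<close>

lemma topological_group_subgroup:
  assumes G: "topological_group G T" and H: "subgroup H G"
  shows "topological_group (G\<lparr>carrier := H\<rparr>) (subtopology T H)"
proof -
  interpret group G using G by (simp add: topological_group_def)
  have T: "topspace T = carrier G"
    and mult: "continuous_map (prod_topology T T) T (\<lambda>(x, y). x \<otimes>\<^bsub>G\<^esub> y)"
    and inv: "continuous_map T T (\<lambda>x. inv\<^bsub>G\<^esub> x)"
    using G by (simp_all add: topological_group_def)
  have "continuous_map (prod_topology (subtopology T H) (subtopology T H)) (subtopology T H)
      (\<lambda>(x, y). x \<otimes>\<^bsub>G\<^esub> y)"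
    using subgroup.m_closed[OF H] continuous_map_from_subtopology[OF mult, of "H \<times> H"]
    by (auto simp: continuous_map_in_subtopology subtopology_Times)
  \<comment> \<open>Inversion in the restricted group agrees with inversion in \<open>G\<close> on
    \<open>H\<close>, which is where continuity is tested.\<close>
  moreover have "continuous_map (subtopology T H) (subtopology T H) (\<lambda>x. inv\<^bsub>G\<lparr>carrier := H\<rparr>\<^esub> x)"
  proof (rule continuous_map_eq)
    show "continuous_map (subtopology T H) (subtopology T H) (\<lambda>x. inv\<^bsub>G\<^esub> x)"
      using subgroup.m_inv_closed[OF H] continuous_map_from_subtopology[OF inv, of H]
      by (auto simp: continuous_map_in_subtopology)
  qed (simp add: m_inv_consistent[OF H])
  ultimately show ?thesis
    using subgroup.subgroup_is_group[OF H is_group] subgroup.subset[OF H]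
    by (simp add: topological_group_def T Int_absorb1)
qed

theorem theorem5p1:
  fixes G :: "('a, 'b) monoid_scheme" and T :: "'a topology" and H :: "'a set"
  assumes "polish_group G T" and "amenable G T"
    and "H \<lhd> G" and "closedin T H" and "cocompact G T H"
  shows "amenable (G\<lparr>carrier := H\<rparr>) (subtopology T H)"
proof -
  have G: "topological_group G T" using assms(2) by (simp add: amenable_def)
  have "subgroup H G" using assms(3) by (rule normal_imp_subgroup)
  moreover have "\<exists>M. regular_borel_prob X M \<and> invariant_measure (G\<lparr>carrier := H\<rparr>) \<phi> M"
    if "compact_space X" "Hausdorff_space X" "topspace X \<noteq> {}"
      "continuous_action (G\<lparr>carrier := H\<rparr>) (subtopology T H) X \<phi>"
    for X :: "'a set set topology" and \<phi>
  proof -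
    interpret induced_action G T H X \<phi>
      using G assms that by (intro induced_action.intro)
    show ?thesis by (rule exists_invariant_measure[OF assms(2)])
  qed
  ultimately show ?thesis
    using topological_group_subgroup[OF G] by (simp add: amenable_def)
qed

end
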